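(* Let $m\geqslant 2$, let $F$ be a field containing a primitive $m$th root of unity $\zeta$, let $B_1,B_2$ be simple Lie algebras over $F$, and let $\alpha_1,\alpha_2\in F$. Suppose $\theta\colon L_{\alpha_1}(B_1)\to L_{\alpha_2}(B_2)$ is an isomorphism of Lie algebras and $H_{m^2}(\zeta)$-modules. Then there exist $0\leqslant k\leqslant m-1$ and an isomorphism of Lie algebras $\psi\colon B_1\to B_2$ such that $$\theta(b_1,\ldots,b_m)=(\psi(b_{k+1}),\ldots,\psi(b_m),\psi(b_1),\ldots,\psi(b_k))$$ for all $b_i\in B_1$. Moreover, $\alpha_2=\zeta^k\alpha_1$. Conversely, if $B_1\cong B_2$ as ordinary Lie algebras and $\alpha_2=\zeta^k\alpha_1$ for some $k\in\mathbb Z$, then $L_{\alpha_1}(B_1)\cong L_{\alpha_2}(B_2)$ as $H_{m^2}(\zeta)$-module Lie algebras.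
   Context: The Taft algebra $H_{m^2}(\zeta)$ is the unital associative $F$-algebra generated by $c,v$ with relations $c^m=1$, $v^m=0$, $vc=\zeta cv$; it is a Hopf algebra with $\Delta(c)=c\otimes c$, $\Delta(v)=c\otimes v+v\otimes 1$, $\varepsilon(c)=1$, $\varepsilon(v)=0$, $S(c)=c^{-1}$, $S(v)=-c^{-1}v$. An $H_{m^2}(\zeta)$-module Lie algebra is a Lie algebra $L$ over $F$ that is a left $H_{m^2}(\zeta)$-module with $h[a,b]=[h_{(1)}a,h_{(2)}b]$ for all $h$ and all $a,b\in L$. Isomorphisms of such algebras are Lie algebra isomorphisms that are also $H_{m^2}(\zeta)$-module maps. For a simple Lie algebra $B$ over $F$ and $\alpha\in F$, $L_\alpha(B):=B\oplus\dots\oplus B$ ($m$ copies, direct sum of ideals) is the $H_{m^2}(\zeta)$-module Lie algebra with $$c(a_1,a_2,\ldots,a_m)=(a_m,a_1,a_2,\ldots,a_{m-1}),$$ $$v(a_1,\ldots,a_m)=\alpha\left(a_1-a_m,\ \zeta(a_2-a_1),\ \ldots,\ \zeta^{m-1}(a_m-a_{m-1})\right).$$ *)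

theory Defs
  imports "HOL-Algebra.QuotRing" "HOL-Algebra.Module"
begin

section \<open>Lie algebras over a field\<close>

text \<open>As for \<^locale>\<open>algebra\<close>, an algebra over \<open>F\<close> is a \<open>module\<close> record. The field
  \<^const>\<open>mult\<close> is the Lie bracket: \<open>a \<otimes>\<^bsub>L\<^esub> b\<close> stands for \<open>[a, b]\<close>. The
  record field \<^const>\<open>one\<close> plays no role.\<close>

locale lie_algebra = field F + module F L for F (structure) and L (structure) +
  assumes bracket_closed:
      "\<lbrakk>a \<in> carrier L; b \<in> carrier L\<rbrakk> \<Longrightarrow> a \<otimes>\<^bsub>L\<^esub> b \<in> carrier L"
    and bracket_l_distr:
      "\<lbrakk>a \<in> carrier L; b \<in> carrier L; d \<in> carrier L\<rbrakk>
        \<Longrightarrow> (a \<oplus>\<^bsub>L\<^esub> b) \<otimes>\<^bsub>L\<^esub> d = a \<otimes>\<^bsub>L\<^esub> d \<oplus>\<^bsub>L\<^esub> b \<otimes>\<^bsub>L\<^esub> d"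
    and bracket_r_distr:
      "\<lbrakk>a \<in> carrier L; b \<in> carrier L; d \<in> carrier L\<rbrakk>
        \<Longrightarrow> d \<otimes>\<^bsub>L\<^esub> (a \<oplus>\<^bsub>L\<^esub> b) = d \<otimes>\<^bsub>L\<^esub> a \<oplus>\<^bsub>L\<^esub> d \<otimes>\<^bsub>L\<^esub> b"
    and bracket_smult_l:
      "\<lbrakk>x \<in> carrier F; a \<in> carrier L; b \<in> carrier L\<rbrakk>
        \<Longrightarrow> (x \<odot>\<^bsub>L\<^esub> a) \<otimes>\<^bsub>L\<^esub> b = x \<odot>\<^bsub>L\<^esub> (a \<otimes>\<^bsub>L\<^esub> b)"
    and bracket_smult_r:
      "\<lbrakk>x \<in> carrier F; a \<in> carrier L; b \<in> carrier L\<rbrakk>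
        \<Longrightarrow> a \<otimes>\<^bsub>L\<^esub> (x \<odot>\<^bsub>L\<^esub> b) = x \<odot>\<^bsub>L\<^esub> (a \<otimes>\<^bsub>L\<^esub> b)"
    and bracket_alternating:
      "a \<in> carrier L \<Longrightarrow> a \<otimes>\<^bsub>L\<^esub> a = \<zero>\<^bsub>L\<^esub>"
    and jacobi:
      "\<lbrakk>a \<in> carrier L; b \<in> carrier L; d \<in> carrier L\<rbrakk>
        \<Longrightarrow> a \<otimes>\<^bsub>L\<^esub> (b \<otimes>\<^bsub>L\<^esub> d) \<oplus>\<^bsub>L\<^esub> b \<otimes>\<^bsub>L\<^esub> (d \<otimes>\<^bsub>L\<^esub> a) \<oplus>\<^bsub>L\<^esub> d \<otimes>\<^bsub>L\<^esub> (a \<otimes>\<^bsub>L\<^esub> b)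
              = \<zero>\<^bsub>L\<^esub>"

definition lie_ideal ::
    "'a set \<Rightarrow> ('f, 'r) ring_scheme \<Rightarrow> ('f, 'a, 's) module_scheme \<Rightarrow> bool" where
  "lie_ideal I F L \<longleftrightarrow>
     submodule I F L \<and> (\<forall>a\<in>carrier L. \<forall>b\<in>I. a \<otimes>\<^bsub>L\<^esub> b \<in> I)"

locale simple_lie_algebra = lie_algebra +
  assumes not_abelian:
      "\<exists>a\<in>carrier L. \<exists>b\<in>carrier L. a \<otimes>\<^bsub>L\<^esub> b \<noteq> \<zero>\<^bsub>L\<^esub>"
    and no_proper_ideals:
      "lie_ideal I F L \<Longrightarrow> I = {\<zero>\<^bsub>L\<^esub>} \<or> I = carrier L"

definition lie_iso ::
    "('f, 'r) ring_scheme \<Rightarrow> ('f, 'a, 's) module_scheme \<Rightarrow> ('f, 'b, 't) module_scheme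
      \<Rightarrow> ('a \<Rightarrow> 'b) set" where
  "lie_iso F L M = {\<phi>. bij_betw \<phi> (carrier L) (carrier M) \<and>
     (\<forall>a\<in>carrier L. \<forall>b\<in>carrier L. \<phi> (a \<oplus>\<^bsub>L\<^esub> b) = \<phi> a \<oplus>\<^bsub>M\<^esub> \<phi> b) \<and>
     (\<forall>x\<in>carrier F. \<forall>a\<in>carrier L. \<phi> (x \<odot>\<^bsub>L\<^esub> a) = x \<odot>\<^bsub>M\<^esub> \<phi> a) \<and>
     (\<forall>a\<in>carrier L. \<forall>b\<in>carrier L. \<phi> (a \<otimes>\<^bsub>L\<^esub> b) = \<phi> a \<otimes>\<^bsub>M\<^esub> \<phi> b)}"


section \<open>The Taft algebra\<close>

definition primitive_root :: "('f, 'r) ring_scheme \<Rightarrow> nat \<Rightarrow> 'f \<Rightarrow> bool" where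
  "primitive_root F m \<zeta> \<longleftrightarrow> \<zeta> \<in> carrier F \<and>
     \<zeta> [^]\<^bsub>F\<^esub> m = \<one>\<^bsub>F\<^esub> \<and> (\<forall>j\<in>{1..<m}. \<zeta> [^]\<^bsub>F\<^esub> j \<noteq> \<one>\<^bsub>F\<^esub>)"

datatype taft_gen = Gen_c | Gen_v

text \<open>The free unital associative algebra \<open>F\<langle>c, v\<rangle>\<close>: finitely supported functions
  from words to \<open>F\<close>, multiplied by convolution along concatenation of words.\<close>

definition free_algebra ::
    "('f, 'r) ring_scheme \<Rightarrow> ('f, taft_gen list \<Rightarrow> 'f) module" where
  "free_algebra F =
    \<lparr>carrier = {f. range f \<subseteq> carrier F \<and> finite {w. f w \<noteq> \<zero>\<^bsub>F\<^esub>}},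
     mult = (\<lambda>f g w. \<Oplus>\<^bsub>F\<^esub>i\<in>{..length w}. f (take i w) \<otimes>\<^bsub>F\<^esub> g (drop i w)),
     one = (\<lambda>w. if w = [] then \<one>\<^bsub>F\<^esub> else \<zero>\<^bsub>F\<^esub>),
     zero = (\<lambda>w. \<zero>\<^bsub>F\<^esub>),
     add = (\<lambda>f g w. f w \<oplus>\<^bsub>F\<^esub> g w),
     smult = (\<lambda>x f w. x \<otimes>\<^bsub>F\<^esub> f w)\<rparr>"

definition free_word :: "('f, 'r) ring_scheme \<Rightarrow> taft_gen list \<Rightarrow> taft_gen list \<Rightarrow> 'f" where
  "free_word F w = (\<lambda>u. if u = w then \<one>\<^bsub>F\<^esub> else \<zero>\<^bsub>F\<^esub>)"

definition taft_relators ::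
    "('f, 'r) ring_scheme \<Rightarrow> nat \<Rightarrow> 'f \<Rightarrow> (taft_gen list \<Rightarrow> 'f) set" where
  "taft_relators F m \<zeta> =
    (let A = free_algebra F; c = free_word F [Gen_c]; v = free_word F [Gen_v]
     in {c [^]\<^bsub>A\<^esub> m \<ominus>\<^bsub>A\<^esub> \<one>\<^bsub>A\<^esub>, v [^]\<^bsub>A\<^esub> m, v \<otimes>\<^bsub>A\<^esub> c \<ominus>\<^bsub>A\<^esub> \<zeta> \<odot>\<^bsub>A\<^esub> (c \<otimes>\<^bsub>A\<^esub> v)})"

definition taft_ideal ::
    "('f, 'r) ring_scheme \<Rightarrow> nat \<Rightarrow> 'f \<Rightarrow> (taft_gen list \<Rightarrow> 'f) set" where
  "taft_ideal F m \<zeta> = Idl\<^bsub>free_algebra F\<^esub> (taft_relators F m \<zeta>)"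

definition taft_algebra ::
    "('f, 'r) ring_scheme \<Rightarrow> nat \<Rightarrow> 'f \<Rightarrow> (taft_gen list \<Rightarrow> 'f) set ring" where
  "taft_algebra F m \<zeta> = free_algebra F Quot taft_ideal F m \<zeta>"

definition taft_class ::
    "('f, 'r) ring_scheme \<Rightarrow> nat \<Rightarrow> 'f \<Rightarrow> (taft_gen list \<Rightarrow> 'f) \<Rightarrow> (taft_gen list \<Rightarrow> 'f) set" where
  "taft_class F m \<zeta> f = taft_ideal F m \<zeta> +>\<^bsub>free_algebra F\<^esub> f"

text \<open>The comultiplication on words. Multiplying out \<open>\<Delta>(c) = c \<otimes> c\<close> and
  \<open>\<Delta>(v) = c \<otimes> v + v \<otimes> 1\<close> along a word \<open>w\<close> writes \<open>\<Delta>(w)\<close> as the sum of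
  \<open>p \<otimes> q\<close> over the pairs \<open>(p, q)\<close> in \<open>taft_comult w\<close>. All coefficients are 1,
  since the first factor \<open>p\<close> determines which summand was chosen at each letter, and so no
  pair arises twice.\<close>

fun taft_comult :: "taft_gen list \<Rightarrow> (taft_gen list \<times> taft_gen list) set" where
  "taft_comult [] = {([], [])}"
| "taft_comult (Gen_c # w) = (\<lambda>(p, q). (Gen_c # p, Gen_c # q)) ` taft_comult w"
| "taft_comult (Gen_v # w) =
     (\<lambda>(p, q). (Gen_c # p, Gen_v # q)) ` taft_comult w \<union>
     (\<lambda>(p, q). (Gen_v # p, q)) ` taft_comult w"


section \<open>Module Lie algebras over the Taft algebra\<close>

record ('f, 'a) taft_lie = "('f, 'a) module" +
  taft_act :: "(taft_gen list \<Rightarrow> 'f) set \<Rightarrow> 'a \<Rightarrow> 'a"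

text \<open>In \<open>act_bracket\<close> the element \<open>h\<close> is the class of \<open>f = \<Sum> f(w) w\<close>, so the right-hand
  side is \<open>[h\<^sub>(\<^sub>1\<^sub>) a, h\<^sub>(\<^sub>2\<^sub>) b]\<close>.\<close>

locale taft_module_lie_algebra = lie_algebra F L
  for F (structure) and m :: nat and \<zeta> and L (structure) +
  assumes act_closed:
      "\<lbrakk>h \<in> carrier (taft_algebra F m \<zeta>); a \<in> carrier L\<rbrakk> \<Longrightarrow> taft_act L h a \<in> carrier L"
    and act_add_r:
      "\<lbrakk>h \<in> carrier (taft_algebra F m \<zeta>); a \<in> carrier L; b \<in> carrier L\<rbrakk>
        \<Longrightarrow> taft_act L h (a \<oplus>\<^bsub>L\<^esub> b) = taft_act L h a \<oplus>\<^bsub>L\<^esub> taft_act L h b"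
    and act_add_l:
      "\<lbrakk>h \<in> carrier (taft_algebra F m \<zeta>); h' \<in> carrier (taft_algebra F m \<zeta>); a \<in> carrier L\<rbrakk>
        \<Longrightarrow> taft_act L (h \<oplus>\<^bsub>taft_algebra F m \<zeta>\<^esub> h') a = taft_act L h a \<oplus>\<^bsub>L\<^esub> taft_act L h' a"
    and act_mult:
      "\<lbrakk>h \<in> carrier (taft_algebra F m \<zeta>); h' \<in> carrier (taft_algebra F m \<zeta>); a \<in> carrier L\<rbrakk>
        \<Longrightarrow> taft_act L (h \<otimes>\<^bsub>taft_algebra F m \<zeta>\<^esub> h') a = taft_act L h (taft_act L h' a)"
    and act_scalar:
      "\<lbrakk>x \<in> carrier F; a \<in> carrier L\<rbrakk>
        \<Longrightarrow> taft_act L (taft_class F m \<zeta> (x \<odot>\<^bsub>free_algebra F\<^esub> \<one>\<^bsub>free_algebra F\<^esub>)) a = x \<odot>\<^bsub>L\<^esub> a"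
    and act_bracket:
      "\<lbrakk>f \<in> carrier (free_algebra F); a \<in> carrier L; b \<in> carrier L\<rbrakk>
        \<Longrightarrow> taft_act L (taft_class F m \<zeta> f) (a \<otimes>\<^bsub>L\<^esub> b) =
          (\<Oplus>\<^bsub>L\<^esub>w\<in>{w. f w \<noteq> \<zero>\<^bsub>F\<^esub>}. f w \<odot>\<^bsub>L\<^esub>
            (\<Oplus>\<^bsub>L\<^esub>pq\<in>taft_comult w.
               taft_act L (taft_class F m \<zeta> (free_word F (fst pq))) a \<otimes>\<^bsub>L\<^esub>
               taft_act L (taft_class F m \<zeta> (free_word F (snd pq))) b))"

definition taft_lie_iso ::
    "('f, 'r) ring_scheme \<Rightarrow> nat \<Rightarrow> 'f \<Rightarrow> ('f, 'a, 's) taft_lie_scheme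
      \<Rightarrow> ('f, 'b, 't) taft_lie_scheme \<Rightarrow> ('a \<Rightarrow> 'b) set" where
  "taft_lie_iso F m \<zeta> L M = {\<theta>. \<theta> \<in> lie_iso F L M \<and>
     (\<forall>h\<in>carrier (taft_algebra F m \<zeta>). \<forall>a\<in>carrier L.
        \<theta> (taft_act L h a) = taft_act M h (\<theta> a))}"

definition taft_lie_isomorphic ::
    "('f, 'r) ring_scheme \<Rightarrow> nat \<Rightarrow> 'f \<Rightarrow> ('f, 'a, 's) taft_lie_scheme
      \<Rightarrow> ('f, 'b, 't) taft_lie_scheme \<Rightarrow> bool" where
  "taft_lie_isomorphic F m \<zeta> L M \<longleftrightarrow>
     taft_module_lie_algebra F m \<zeta> L \<and> taft_module_lie_algebra F m \<zeta> M \<and>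
     taft_lie_iso F m \<zeta> L M \<noteq> {}"


section \<open>The algebras \<open>L\<^sub>\<alpha>(B)\<close>\<close>

text \<open>The tuple \<open>(a\<^sub>1, \<dots>, a\<^sub>m)\<close> is an extensional function on \<open>{1..m}\<close>.\<close>

definition lie_power :: "nat \<Rightarrow> ('f, 'a, 's) module_scheme \<Rightarrow> ('f, nat \<Rightarrow> 'a) module" where
  "lie_power m B =
    \<lparr>carrier = {1..m} \<rightarrow>\<^sub>E carrier B,
     mult = (\<lambda>a b. \<lambda>i\<in>{1..m}. a i \<otimes>\<^bsub>B\<^esub> b i),
     one = undefined,
     zero = (\<lambda>i\<in>{1..m}. \<zero>\<^bsub>B\<^esub>),
     add = (\<lambda>a b. \<lambda>i\<in>{1..m}. a i \<oplus>\<^bsub>B\<^esub> b i),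
     smult = (\<lambda>x a. \<lambda>i\<in>{1..m}. x \<odot>\<^bsub>B\<^esub> a i)\<rparr>"

definition cyc_pred :: "nat \<Rightarrow> nat \<Rightarrow> nat" where
  "cyc_pred m i = (if i = 1 then m else i - 1)"

definition L_c :: "nat \<Rightarrow> (nat \<Rightarrow> 'a) \<Rightarrow> (nat \<Rightarrow> 'a)" where
  "L_c m a = (\<lambda>i\<in>{1..m}. a (cyc_pred m i))"

definition L_v ::
    "('f, 'r) ring_scheme \<Rightarrow> nat \<Rightarrow> 'f \<Rightarrow> 'f \<Rightarrow> ('f, 'a, 's) module_scheme
      \<Rightarrow> (nat \<Rightarrow> 'a) \<Rightarrow> (nat \<Rightarrow> 'a)" where
  "L_v F m \<zeta> \<alpha> B a =
     (\<lambda>i\<in>{1..m}. \<alpha> \<odot>\<^bsub>B\<^esub> (\<zeta> [^]\<^bsub>F\<^esub> (i - 1) \<odot>\<^bsub>B\<^esub> (a i \<ominus>\<^bsub>B\<^esub> a (cyc_pred m i))))"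

text \<open>The action of \<open>F\<langle>c, v\<rangle>\<close> in which the generators act by the operators \<open>C\<close> and \<open>V\<close>;
  the first letter of a word acts last.\<close>

definition free_act ::
    "('f, 'r) ring_scheme \<Rightarrow> ('f, 'a, 's) module_scheme \<Rightarrow> ('a \<Rightarrow> 'a) \<Rightarrow> ('a \<Rightarrow> 'a)
      \<Rightarrow> (taft_gen list \<Rightarrow> 'f) \<Rightarrow> 'a \<Rightarrow> 'a" where
  "free_act F L C V f a =
     (\<Oplus>\<^bsub>L\<^esub>w\<in>{w. f w \<noteq> \<zero>\<^bsub>F\<^esub>}.
        f w \<odot>\<^bsub>L\<^esub> foldr (\<lambda>g. case g of Gen_c \<Rightarrow> C | Gen_v \<Rightarrow> V) w a)"

text \<open>An element \<open>h\<close> of the Taft algebra is a coset. All its representatives \<open>f\<close> act in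
  the same way, because the operators \<open>L_c\<close> and \<open>L_v\<close> satisfy the defining relations when
  \<open>\<zeta>\<close> is a primitive \<open>m\<close>th root of unity; this common value is the action of \<open>h\<close>.\<close>

definition L_alg ::
    "('f, 'r) ring_scheme \<Rightarrow> nat \<Rightarrow> 'f \<Rightarrow> 'f \<Rightarrow> ('f, 'a, 's) module_scheme
      \<Rightarrow> ('f, nat \<Rightarrow> 'a) taft_lie" where
  "L_alg F m \<zeta> \<alpha> B = module.extend (lie_power m B)
     \<lparr>taft_act = (\<lambda>h a.
        the_elem ((\<lambda>f. free_act F (lie_power m B) (L_c m) (L_v F m \<zeta> \<alpha> B) f a) ` h))\<rparr>"

end

(* Write v = alpha D (1 - c) with D the diagonal operator of the powers of zeta. It maps the function
   i |-> zeta^(j (i-1)) on positions to a multiple of i |-> zeta^((j+1) (i-1)), with coefficient 0 if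
   m divides j. Since these functions span all functions on m positions, v^m = 0, so c and v make
   L_alpha(B) a module over the Taft algebra.

   The copies of a simple algebra B in B^m are the minimal ideals of B^m because B has trivial
   centre. Hence an isomorphism theta of powers permutes the copies; commuting with c forces the
   permutation to be a rotation and all components to agree with a single psi. Evaluating
   theta v = v theta on one element concentrated in a single copy compares the parameters. *)

theory Submission
  imports Defs
begin

section \<open>The free algebra on c and v\<close>

text \<open>An element of the Taft algebra acts by the common value of all representatives of its
  coset. For this value to exist, the functions acting by zero must form a two-sided ideal
  containing the relators, and so the action of the free algebra must first be shown to be
  multiplicative. Left derivatives, which strip the first letter of a word, give convolution and
  action the same recursion.

  Nilpotency of v is proved on tuples concentrated at one position, obtained by Lagrange
  interpolation at the m distinct values of \<zeta>^(i-1), without counting dimensions. Degrees run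
  from 1 to m rather than from 0 to m-1: they then only grow until degree m, where v gives 0, and m
  steps suffice from every degree.

  The permutation of the copies is never constructed. Only the copy that \<theta> carries onto the
  first coordinate is located; \<psi> and k are read off from it, and commuting with c transports
  the formula to the other coordinates. In the converse this formula defines the map, once the
  integer exponent is reduced below m.\<close>

lemma carrier_free_algebra:
  "f \<in> carrier (free_algebra F) \<longleftrightarrow> (\<forall>w. f w \<in> carrier F) \<and> finite {w. f w \<noteq> \<zero>\<^bsub>F\<^esub>}"
  by (auto simp: free_algebra_def)

lemma free_algebra_simps:
  "\<zero>\<^bsub>free_algebra F\<^esub> = (\<lambda>w. \<zero>\<^bsub>F\<^esub>)"
  "\<one>\<^bsub>free_algebra F\<^esub> = free_word F []"
  "f \<oplus>\<^bsub>free_algebra F\<^esub> g = (\<lambda>w. f w \<oplus>\<^bsub>F\<^esub> g w)"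
  "x \<odot>\<^bsub>free_algebra F\<^esub> f = (\<lambda>w. x \<otimes>\<^bsub>F\<^esub> f w)"
  by (auto simp: free_algebra_def free_word_def)

text \<open>Separated from the record of the free algebra so that the identities below need only
  values in the carrier, not finite support.\<close>

definition convolve ::
    "('f, 'r) ring_scheme \<Rightarrow> (taft_gen list \<Rightarrow> 'f) \<Rightarrow> (taft_gen list \<Rightarrow> 'f) \<Rightarrow> taft_gen list \<Rightarrow> 'f"
  where "convolve F f g w = (\<Oplus>\<^bsub>F\<^esub>i\<in>{..length w}. f (take i w) \<otimes>\<^bsub>F\<^esub> g (drop i w))"

lemma mult_free_algebra: "f \<otimes>\<^bsub>free_algebra F\<^esub> g = convolve F f g"
  by (auto simp: free_algebra_def convolve_def fun_eq_iff)

context ring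
begin

lemma convolve_closed [simp]:
  assumes "\<And>w. f w \<in> carrier R" "\<And>w. g w \<in> carrier R"
  shows "convolve R f g w \<in> carrier R"
  unfolding convolve_def using assms by (intro finsum_closed) auto

lemma convolve_Nil:
  assumes "\<And>w. f w \<in> carrier R" "\<And>w. g w \<in> carrier R"
  shows "convolve R f g [] = f [] \<otimes> g []"
  unfolding convolve_def using assms by simp

text \<open>Left derivatives of words turn every identity for convolutions into an induction on the
  word at which it is evaluated.\<close>

lemma convolve_Cons:
  assumes "\<And>w. f w \<in> carrier R" "\<And>w. g w \<in> carrier R"
  shows "convolve R f g (x # w) = f [] \<otimes> g (x # w) \<oplus> convolve R (\<lambda>u. f (x # u)) g w"
proof -
  let ?t = "\<lambda>i. f (take i (x # w)) \<otimes> g (drop i (x # w))"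
  have "convolve R f g (x # w) = (\<Oplus>i\<in>{..length w}. ?t (Suc i)) \<oplus> ?t 0"
    unfolding convolve_def length_Cons by (rule finsum_Suc2) (use assms in auto)
  also have "\<dots> = f [] \<otimes> g (x # w) \<oplus> convolve R (\<lambda>u. f (x # u)) g w"
    unfolding convolve_def using assms by (subst a_comm) (auto intro!: finsum_closed)
  finally show ?thesis .
qed

lemma convolve_smult_left:
  assumes "x \<in> carrier R" "\<And>w. f w \<in> carrier R" "\<And>w. g w \<in> carrier R"
  shows "convolve R (\<lambda>w. x \<otimes> f w) g w = x \<otimes> convolve R f g w"
  using assms(2)
  by (induction w arbitrary: f)
    (use assms(1,3) in \<open>simp_all add: convolve_Nil convolve_Cons m_assoc r_distr\<close>)

lemma convolve_add_left:
  assumes "\<And>w. f w \<in> carrier R" "\<And>w. f' w \<in> carrier R" "\<And>w. g w \<in> carrier R"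
  shows "convolve R (\<lambda>w. f w \<oplus> f' w) g w = convolve R f g w \<oplus> convolve R f' g w"
  using assms(1,2)
  by (induction w arbitrary: f f')
    (use assms(3) in \<open>simp_all add: convolve_Nil convolve_Cons l_distr a_ac\<close>)

lemma convolve_add_right:
  assumes "\<And>w. f w \<in> carrier R" "\<And>w. g w \<in> carrier R" "\<And>w. g' w \<in> carrier R"
  shows "convolve R f (\<lambda>w. g w \<oplus> g' w) w = convolve R f g w \<oplus> convolve R f g' w"
  using assms(1)
  by (induction w arbitrary: f)
    (use assms(2,3) in \<open>simp_all add: convolve_Nil convolve_Cons r_distr a_ac\<close>)

lemma convolve_zero_left:
  assumes "\<And>w. g w \<in> carrier R"
  shows "convolve R (\<lambda>w. \<zero>) g w = \<zero>"
  by (induction w) (use assms in \<open>simp_all add: convolve_Nil convolve_Cons\<close>)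

text \<open>Differentiating \<open>convolve R f g\<close> leaves a multiple of the derivative of
  \<open>g\<close> plus the convolution of the derivative of \<open>f\<close> with \<open>g\<close>.
  Linearity in the left factor separates the two, and the induction hypothesis is used for the
  derivative of \<open>f\<close>.\<close>

lemma convolve_assoc:
  assumes "\<And>w. f w \<in> carrier R" "\<And>w. g w \<in> carrier R" "\<And>w. h w \<in> carrier R"
  shows "convolve R (convolve R f g) h w = convolve R f (convolve R g h) w"
  using assms(1,2)
proof (induction w arbitrary: f g)
  case Nil
  then show ?case using assms(3) by (simp add: convolve_Nil m_assoc)
next
  case (Cons x w)
  then show ?case using assms(3)
    by (simp add: convolve_Cons convolve_Nil convolve_add_left convolve_smult_left
        r_distr m_assoc a_assoc)
qed

lemma convolve_one_left:
  assumes "\<And>w. f w \<in> carrier R"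
  shows "convolve R (free_word R []) f w = f w"
  using assms by (cases w) (simp_all add: convolve_Nil convolve_Cons convolve_zero_left free_word_def)

lemma convolve_one_right:
  assumes "\<And>w. f w \<in> carrier R"
  shows "convolve R f (free_word R []) w = f w"
  using assms by (induction w arbitrary: f) (simp_all add: convolve_Nil convolve_Cons free_word_def)

text \<open>A nonzero value at a word needs a nonzero summand, which cuts the word into one word
  from each support.\<close>

lemma finite_support_convolve:
  assumes "f \<in> carrier (free_algebra R)" "g \<in> carrier (free_algebra R)"
  shows "finite {w. convolve R f g w \<noteq> \<zero>}"
proof (rule finite_subset)
  have f: "\<And>w. f w \<in> carrier R" "finite {w. f w \<noteq> \<zero>}"
    and g: "\<And>w. g w \<in> carrier R" "finite {w. g w \<noteq> \<zero>}"
    using assms by (auto simp: carrier_free_algebra)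
  show "finite ((\<lambda>(u, v). u @ v) ` ({w. f w \<noteq> \<zero>} \<times> {w. g w \<noteq> \<zero>}))"
    using f(2) g(2) by blast
  show "{w. convolve R f g w \<noteq> \<zero>}
    \<subseteq> (\<lambda>(u, v). u @ v) ` ({w. f w \<noteq> \<zero>} \<times> {w. g w \<noteq> \<zero>})"
  proof
    fix w assume "w \<in> {w. convolve R f g w \<noteq> \<zero>}"
    then have "\<exists>i. f (take i w) \<otimes> g (drop i w) \<noteq> \<zero>"
      unfolding convolve_def by (metis (mono_tags, lifting) add.finprod_one_eqI mem_Collect_eq)
    then obtain i where "f (take i w) \<otimes> g (drop i w) \<noteq> \<zero>" ..
    then have "f (take i w) \<noteq> \<zero>" "g (drop i w) \<noteq> \<zero>"
      using f(1) g(1) by auto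
    then show "w \<in> (\<lambda>(u, v). u @ v) ` ({w. f w \<noteq> \<zero>} \<times> {w. g w \<noteq> \<zero>})"
      by (intro image_eqI[of _ _ "(take i w, drop i w)"]) auto
  qed
qed

lemma finite_support_add:
  assumes "finite {w. f w \<noteq> \<zero>}" "finite {w. g w \<noteq> \<zero>}"
  shows "finite {w. f w \<oplus> g w \<noteq> \<zero>}"
  by (rule finite_subset[OF _ finite_UnI[OF assms]]) auto

lemma free_word_closed [simp]: "free_word R w u \<in> carrier R"
  by (simp add: free_word_def)

lemma finite_support_free_word [simp]: "finite {u. free_word R w u \<noteq> \<zero>}"
  by (simp add: free_word_def)

lemma free_word_carrier [simp]: "free_word R w \<in> carrier (free_algebra R)"
  by (simp add: carrier_free_algebra)

lemma ring_free_algebra: "ring (free_algebra R)"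
proof (rule ringI)
  show "abelian_group (free_algebra R)"
  proof (rule abelian_groupI)
    fix f assume "f \<in> carrier (free_algebra R)"
    then have f: "\<And>w. f w \<in> carrier R" "finite {w. f w \<noteq> \<zero>}"
      by (auto simp: carrier_free_algebra)
    have "finite {w. \<ominus> f w \<noteq> \<zero>}"
      by (rule finite_subset[OF _ f(2)]) auto
    then show "\<exists>g\<in>carrier (free_algebra R). g \<oplus>\<^bsub>free_algebra R\<^esub> f = \<zero>\<^bsub>free_algebra R\<^esub>"
      using f(1) by (intro bexI[of _ "\<lambda>w. \<ominus> f w"])
        (simp_all add: carrier_free_algebra free_algebra_simps l_neg)
  qed (simp_all add: carrier_free_algebra free_algebra_simps finite_support_add a_ac)
  show "monoid (free_algebra R)"
    by (rule monoidI)
      (use finite_support_convolve in \<open>auto simp: carrier_free_algebra mult_free_algebra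
        free_algebra_simps(2) convolve_assoc convolve_one_left convolve_one_right fun_eq_iff\<close>)
qed (auto simp: carrier_free_algebra free_algebra_simps mult_free_algebra
    convolve_add_left convolve_add_right fun_eq_iff)

end


section \<open>Operators satisfying the Taft relations\<close>

lemma additive_finsum:
  assumes "abelian_group G" "abelian_group H"
    and T_closed: "\<And>a. a \<in> carrier G \<Longrightarrow> T a \<in> carrier H"
    and T_add: "\<And>a b. \<lbrakk>a \<in> carrier G; b \<in> carrier G\<rbrakk> \<Longrightarrow> T (a \<oplus>\<^bsub>G\<^esub> b) = T a \<oplus>\<^bsub>H\<^esub> T b"
    and g: "g \<in> A \<rightarrow> carrier G"
  shows "T (finsum G g A) = finsum H (\<lambda>i. T (g i)) A"
proof -
  interpret G: abelian_group G by fact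
  interpret H: abelian_group H by fact
  have zero: "T \<zero>\<^bsub>G\<^esub> = \<zero>\<^bsub>H\<^esub>"
    using T_add[of "\<zero>\<^bsub>G\<^esub>" "\<zero>\<^bsub>G\<^esub>"] T_closed[of "\<zero>\<^bsub>G\<^esub>"] by (simp add: H.add.r_cancel_one')
  \<comment> \<open>Infinite index sets are included: both sums are then zero by convention, so
    \<open>zero\<close> settles that case too.\<close>
  show ?thesis
    using g
    by (induction A rule: infinite_finite_induct) (simp_all add: zero T_closed T_add Pi_def)
qed

text \<open>Sums see only the additive part of a record, so they do not change when a Lie algebra is
  extended by a Taft action.\<close>

lemma finsum_cong_ring:
  assumes "carrier G = carrier H" "add G = add H" "zero G = zero H"
  shows "finsum G = finsum H"
  by (intro ext) (simp add: finsum_def finprod_def assms)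

lemma finite_taft_comult: "finite (taft_comult w)"
  by (induction w rule: taft_comult.induct) auto

text \<open>What two linear operators must satisfy to define a Taft module structure on a Lie
  algebra. \<open>C_bracket\<close> and \<open>V_bracket\<close> express \<Delta>(c) and
  \<Delta>(v), the latter as a skew Leibniz rule; the last three assumptions are the defining
  relations.\<close>

locale taft_operators = lie_algebra F L
  for F :: "('f, 'r) ring_scheme" (structure) and L :: "('f, 'a) module" (structure) +
  fixes m :: nat and \<zeta> :: 'f and C V :: "'a \<Rightarrow> 'a"
  assumes \<zeta>_closed [simp]: "\<zeta> \<in> carrier F"
    and C_closed [simp]: "a \<in> carrier L \<Longrightarrow> C a \<in> carrier L"
    and C_add: "\<lbrakk>a \<in> carrier L; b \<in> carrier L\<rbrakk> \<Longrightarrow> C (a \<oplus>\<^bsub>L\<^esub> b) = C a \<oplus>\<^bsub>L\<^esub> C b"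
    and C_smult: "\<lbrakk>x \<in> carrier F; a \<in> carrier L\<rbrakk> \<Longrightarrow> C (x \<odot>\<^bsub>L\<^esub> a) = x \<odot>\<^bsub>L\<^esub> C a"
    and C_bracket: "\<lbrakk>a \<in> carrier L; b \<in> carrier L\<rbrakk> \<Longrightarrow> C (a \<otimes>\<^bsub>L\<^esub> b) = C a \<otimes>\<^bsub>L\<^esub> C b"
    and V_closed [simp]: "a \<in> carrier L \<Longrightarrow> V a \<in> carrier L"
    and V_add: "\<lbrakk>a \<in> carrier L; b \<in> carrier L\<rbrakk> \<Longrightarrow> V (a \<oplus>\<^bsub>L\<^esub> b) = V a \<oplus>\<^bsub>L\<^esub> V b"
    and V_smult: "\<lbrakk>x \<in> carrier F; a \<in> carrier L\<rbrakk> \<Longrightarrow> V (x \<odot>\<^bsub>L\<^esub> a) = x \<odot>\<^bsub>L\<^esub> V a"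
    and V_bracket: "\<lbrakk>a \<in> carrier L; b \<in> carrier L\<rbrakk>
        \<Longrightarrow> V (a \<otimes>\<^bsub>L\<^esub> b) = C a \<otimes>\<^bsub>L\<^esub> V b \<oplus>\<^bsub>L\<^esub> V a \<otimes>\<^bsub>L\<^esub> b"
    and C_power: "a \<in> carrier L \<Longrightarrow> (C ^^ m) a = a"
    and V_power: "a \<in> carrier L \<Longrightarrow> (V ^^ m) a = \<zero>\<^bsub>L\<^esub>"
    and V_C: "a \<in> carrier L \<Longrightarrow> V (C a) = \<zeta> \<odot>\<^bsub>L\<^esub> C (V a)"
begin

abbreviation word_act :: "taft_gen list \<Rightarrow> 'a \<Rightarrow> 'a" where
  "word_act w a \<equiv> foldr (\<lambda>g. case g of Gen_c \<Rightarrow> C | Gen_v \<Rightarrow> V) w a"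

abbreviation act :: "(taft_gen list \<Rightarrow> 'f) \<Rightarrow> 'a \<Rightarrow> 'a" where
  "act \<equiv> free_act F L C V"

abbreviation A :: "('f, taft_gen list \<Rightarrow> 'f) module" where
  "A \<equiv> free_algebra F"

lemma L_group: "abelian_group L" ..

lemmas C_finsum = additive_finsum[OF L_group L_group C_closed C_add]
lemmas V_finsum = additive_finsum[OF L_group L_group V_closed V_add]

lemma word_act_closed [simp]: "a \<in> carrier L \<Longrightarrow> word_act w a \<in> carrier L"
  by (induction w) (auto split: taft_gen.split)

lemma word_act_add:
  "\<lbrakk>a \<in> carrier L; b \<in> carrier L\<rbrakk> \<Longrightarrow> word_act w (a \<oplus>\<^bsub>L\<^esub> b) = word_act w a \<oplus>\<^bsub>L\<^esub> word_act w b"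
  by (induction w) (auto simp: C_add V_add split: taft_gen.split)

text \<open>Supports vary under addition and scaling, so sums are compared over a common finite set
  of words.\<close>

lemma free_act_superset:
  assumes "finite S" "{w. f w \<noteq> \<zero>\<^bsub>F\<^esub>} \<subseteq> S" "\<And>w. f w \<in> carrier F" "a \<in> carrier L"
  shows "act f a = (\<Oplus>\<^bsub>L\<^esub>w\<in>S. f w \<odot>\<^bsub>L\<^esub> word_act w a)"
  unfolding free_act_def
  by (rule M.add.finprod_mono_neutral_cong_left) (use assms in auto)

lemma act_closed [simp]:
  assumes "f \<in> carrier A" "a \<in> carrier L"
  shows "act f a \<in> carrier L"
  unfolding free_act_def using assms
  by (intro M.finsum_closed) (auto simp: carrier_free_algebra)

lemma act_add_left:
  assumes "f \<in> carrier A" "g \<in> carrier A" "a \<in> carrier L"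
  shows "act (\<lambda>w. f w \<oplus>\<^bsub>F\<^esub> g w) a = act f a \<oplus>\<^bsub>L\<^esub> act g a"
proof -
  let ?S = "{w. f w \<noteq> \<zero>\<^bsub>F\<^esub>} \<union> {w. g w \<noteq> \<zero>\<^bsub>F\<^esub>}"
  have c: "f w \<in> carrier F" "g w \<in> carrier F" for w
    using assms by (auto simp: carrier_free_algebra)
  have S: "finite ?S"
    using assms by (auto simp: carrier_free_algebra)
  have "act f a \<oplus>\<^bsub>L\<^esub> act g a
    = (\<Oplus>\<^bsub>L\<^esub>w\<in>?S. f w \<odot>\<^bsub>L\<^esub> word_act w a) \<oplus>\<^bsub>L\<^esub> (\<Oplus>\<^bsub>L\<^esub>w\<in>?S. g w \<odot>\<^bsub>L\<^esub> word_act w a)"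
    using S assms(3) c by (intro arg_cong2[of _ _ _ _ "add L"] free_act_superset) auto
  also have "\<dots> = (\<Oplus>\<^bsub>L\<^esub>w\<in>?S. f w \<odot>\<^bsub>L\<^esub> word_act w a \<oplus>\<^bsub>L\<^esub> g w \<odot>\<^bsub>L\<^esub> word_act w a)"
    using c assms(3) by (intro M.finsum_addf[symmetric]) auto
  also have "\<dots> = (\<Oplus>\<^bsub>L\<^esub>w\<in>?S. (f w \<oplus>\<^bsub>F\<^esub> g w) \<odot>\<^bsub>L\<^esub> word_act w a)"
    using c assms(3) by (intro M.finsum_cong') (auto simp: smult_l_distr)
  also have "\<dots> = act (\<lambda>w. f w \<oplus>\<^bsub>F\<^esub> g w) a"
    using S assms(3) c by (intro free_act_superset[symmetric]) auto
  finally show ?thesis by simp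
qed

lemma smult_carrier:
  assumes "x \<in> carrier F" "f \<in> carrier A"
  shows "(\<lambda>w. x \<otimes>\<^bsub>F\<^esub> f w) \<in> carrier A"
proof -
  have "finite {w. x \<otimes>\<^bsub>F\<^esub> f w \<noteq> \<zero>\<^bsub>F\<^esub>}"
    by (rule finite_subset[of _ "{w. f w \<noteq> \<zero>\<^bsub>F\<^esub>}"]) (use assms in \<open>auto simp: carrier_free_algebra\<close>)
  then show ?thesis using assms by (auto simp: carrier_free_algebra)
qed

lemma act_smult_left:
  assumes "x \<in> carrier F" "f \<in> carrier A" "a \<in> carrier L"
  shows "act (\<lambda>w. x \<otimes>\<^bsub>F\<^esub> f w) a = x \<odot>\<^bsub>L\<^esub> act f a"
proof -
  let ?S = "{w. f w \<noteq> \<zero>\<^bsub>F\<^esub>}"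
  have c: "\<And>w. f w \<in> carrier F" and S: "finite ?S"
    using assms by (auto simp: carrier_free_algebra)
  have "act (\<lambda>w. x \<otimes>\<^bsub>F\<^esub> f w) a = (\<Oplus>\<^bsub>L\<^esub>w\<in>?S. (x \<otimes>\<^bsub>F\<^esub> f w) \<odot>\<^bsub>L\<^esub> word_act w a)"
    using S assms c by (intro free_act_superset) auto
  also have "\<dots> = (\<Oplus>\<^bsub>L\<^esub>w\<in>?S. x \<odot>\<^bsub>L\<^esub> (f w \<odot>\<^bsub>L\<^esub> word_act w a))"
    using c assms by (intro M.finsum_cong') (auto simp: smult_assoc1)
  also have "\<dots> = x \<odot>\<^bsub>L\<^esub> act f a"
    unfolding free_act_def using S c assms by (intro finsum_smult_ldistr[symmetric]) auto
  finally show ?thesis .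
qed

lemma act_zero_left [simp]: "act (\<lambda>w. \<zero>\<^bsub>F\<^esub>) a = \<zero>\<^bsub>L\<^esub>"
  by (simp add: free_act_def)

lemma act_free_word:
  assumes "a \<in> carrier L"
  shows "act (free_word F w) a = word_act w a"
  using assms by (subst free_act_superset[of "{w}"]) (auto simp: free_word_def)

lemma act_add_right:
  assumes "f \<in> carrier A" "a \<in> carrier L" "b \<in> carrier L"
  shows "act f (a \<oplus>\<^bsub>L\<^esub> b) = act f a \<oplus>\<^bsub>L\<^esub> act f b"
proof -
  have "f w \<in> carrier F" for w using assms by (auto simp: carrier_free_algebra)
  then show ?thesis using assms unfolding free_act_def
    by (subst M.finsum_addf[symmetric])
      (auto intro!: M.finsum_cong' simp: word_act_add smult_r_distr)
qed

lemma derivative_carrier: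
  assumes "f \<in> carrier A"
  shows "(\<lambda>w. f (x # w)) \<in> carrier A"
  using assms finite_vimageI[of "{w. f w \<noteq> \<zero>\<^bsub>F\<^esub>}" "Cons x"]
  by (auto simp: carrier_free_algebra inj_on_def vimage_def)

text \<open>The counterpart of \<open>convolve_Cons\<close> for the action. The first letter of a
  word acts last, so sorting the support by first letter lets \<open>C\<close> and \<open>V\<close>
  be pulled out of the sums.\<close>

lemma act_derivatives:
  assumes f: "f \<in> carrier A" and a: "a \<in> carrier L"
  shows "act f a = f [] \<odot>\<^bsub>L\<^esub> a \<oplus>\<^bsub>L\<^esub>
    (C (act (\<lambda>w. f (Gen_c # w)) a) \<oplus>\<^bsub>L\<^esub> V (act (\<lambda>w. f (Gen_v # w)) a))"
proof -
  let ?S = "\<lambda>x. {w. f (x # w) \<noteq> \<zero>\<^bsub>F\<^esub>}"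
  let ?t = "\<lambda>w. f w \<odot>\<^bsub>L\<^esub> word_act w a"
  have c: "f w \<in> carrier F" for w using f by (auto simp: carrier_free_algebra)
  have t: "?t w \<in> carrier L" for w using c a by simp
  have S: "finite (?S x)" for x
    using derivative_carrier[OF f, of x] by (auto simp: carrier_free_algebra)
  have sup: "{w. f w \<noteq> \<zero>\<^bsub>F\<^esub>} \<subseteq> insert [] (Cons Gen_c ` ?S Gen_c \<union> Cons Gen_v ` ?S Gen_v)"
  proof
    fix w assume "w \<in> {w. f w \<noteq> \<zero>\<^bsub>F\<^esub>}"
    then show "w \<in> insert [] (Cons Gen_c ` ?S Gen_c \<union> Cons Gen_v ` ?S Gen_v)"
      \<comment> \<open>The patterns of \<open>taft_comult\<close> are exactly the three kinds of
        words: empty, starting with c, starting with v.\<close>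
      by (cases w rule: taft_comult.cases) auto
  qed
  have "act f a = finsum L ?t (insert [] (Cons Gen_c ` ?S Gen_c \<union> Cons Gen_v ` ?S Gen_v))"
    by (rule free_act_superset) (use S sup c a in auto)
  also have "\<dots> = ?t [] \<oplus>\<^bsub>L\<^esub> finsum L ?t (Cons Gen_c ` ?S Gen_c \<union> Cons Gen_v ` ?S Gen_v)"
    using S t t[of "[]"] by (intro M.finsum_insert) auto
  also have "finsum L ?t (Cons Gen_c ` ?S Gen_c \<union> Cons Gen_v ` ?S Gen_v)
    = finsum L ?t (Cons Gen_c ` ?S Gen_c) \<oplus>\<^bsub>L\<^esub> finsum L ?t (Cons Gen_v ` ?S Gen_v)"
    using S t by (intro M.finsum_Un_disjoint) auto
  also have "finsum L ?t (Cons Gen_c ` ?S Gen_c) = finsum L (\<lambda>w. ?t (Gen_c # w)) (?S Gen_c)"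
    using t by (intro M.finsum_reindex) auto
  also have "\<dots> = C (act (\<lambda>w. f (Gen_c # w)) a)"
    unfolding free_act_def using c a
    by (subst C_finsum) (auto intro!: M.finsum_cong' simp: C_smult)
  also have "finsum L ?t (Cons Gen_v ` ?S Gen_v) = finsum L (\<lambda>w. ?t (Gen_v # w)) (?S Gen_v)"
    using t by (intro M.finsum_reindex) auto
  also have "\<dots> = V (act (\<lambda>w. f (Gen_v # w)) a)"
    unfolding free_act_def using c a
    by (subst V_finsum) (auto intro!: M.finsum_cong' simp: V_smult)
  finally show ?thesis by simp
qed

lemma convolve_carrier:
  "\<lbrakk>f \<in> carrier A; g \<in> carrier A\<rbrakk> \<Longrightarrow> convolve F f g \<in> carrier A"
  using finite_support_convolve[of f g] by (simp add: carrier_free_algebra)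

lemma support_length_bounded:
  assumes "f \<in> carrier A"
  obtains n where "\<And>w. f w \<noteq> \<zero>\<^bsub>F\<^esub> \<Longrightarrow> length w < n"
proof -
  have "finite (length ` {w. f w \<noteq> \<zero>\<^bsub>F\<^esub>})"
    using assms by (auto simp: carrier_free_algebra)
  then obtain n where "\<forall>k\<in>length ` {w. f w \<noteq> \<zero>\<^bsub>F\<^esub>}. k < n"
    unfolding finite_nat_set_iff_bounded by blast
  with that show ?thesis by blast
qed

text \<open>Both sides unfold through derivatives. The induction is on a strict bound for the length
  of words in the support of \<open>f\<close>: it drops by one under differentiation, and the bound
  0 forces \<open>f\<close> to be zero.\<close>

lemma act_convolve:
  assumes f: "f \<in> carrier A" and g: "g \<in> carrier A" and a: "a \<in> carrier L"
  shows "act (convolve F f g) a = act f (act g a)"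
proof -
  have gc: "\<And>w. g w \<in> carrier F" using g by (simp add: carrier_free_algebra)
  obtain n where "\<And>w. f w \<noteq> \<zero>\<^bsub>F\<^esub> \<Longrightarrow> length w < n"
    using support_length_bounded[OF f] by blast
  with f show ?thesis
  proof (induction n arbitrary: f)
    case 0
    then have f0: "f = (\<lambda>w. \<zero>\<^bsub>F\<^esub>)" by auto
    have "convolve F f g = (\<lambda>w. \<zero>\<^bsub>F\<^esub>)"
      unfolding f0 by (rule ext) (rule convolve_zero_left[OF gc])
    then show ?case by (simp add: f0)
  next
    case (Suc n)
    have fc: "\<And>w. f w \<in> carrier F" using Suc.prems by (simp add: carrier_free_algebra)
    have fd: "(\<lambda>w. f (x # w)) \<in> carrier A" for x using derivative_carrier Suc.prems by simp
    have IH: "act (convolve F (\<lambda>w. f (x # w)) g) a = act (\<lambda>w. f (x # w)) (act g a)" for x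
      by (rule Suc.IH) (use fd Suc.prems(2)[of "x # _"] in auto)
    \<comment> \<open>The derivative of a product, from \<open>convolve_Cons\<close>, with the
      induction hypothesis already applied to its second summand.\<close>
    have D: "act (\<lambda>w. convolve F f g (x # w)) a
      = f [] \<odot>\<^bsub>L\<^esub> act (\<lambda>w. g (x # w)) a \<oplus>\<^bsub>L\<^esub> act (\<lambda>w. f (x # w)) (act g a)" for x
    proof -
      have "(\<lambda>w. convolve F f g (x # w))
        = (\<lambda>w. (f [] \<otimes>\<^bsub>F\<^esub> g (x # w)) \<oplus>\<^bsub>F\<^esub> convolve F (\<lambda>w. f (x # w)) g w)"
        using fc gc by (simp add: convolve_Cons)
      then show ?thesis
        using fc fd g a
        by (simp add: act_add_left smult_carrier derivative_carrier convolve_carrier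
            act_smult_left IH)
    qed
    have gd: "(\<lambda>w. g (x # w)) \<in> carrier A" for x using derivative_carrier g by simp
    have "act (convolve F f g) a = (f [] \<otimes>\<^bsub>F\<^esub> g []) \<odot>\<^bsub>L\<^esub> a \<oplus>\<^bsub>L\<^esub>
      (C (act (\<lambda>w. convolve F f g (Gen_c # w)) a) \<oplus>\<^bsub>L\<^esub> V (act (\<lambda>w. convolve F f g (Gen_v # w)) a))"
      using Suc.prems g a fc gc
      by (simp add: act_derivatives[OF convolve_carrier] convolve_Nil)
    also have "\<dots> = f [] \<odot>\<^bsub>L\<^esub> (g [] \<odot>\<^bsub>L\<^esub> a \<oplus>\<^bsub>L\<^esub>
        (C (act (\<lambda>w. g (Gen_c # w)) a) \<oplus>\<^bsub>L\<^esub> V (act (\<lambda>w. g (Gen_v # w)) a))) \<oplus>\<^bsub>L\<^esub>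
      (C (act (\<lambda>w. f (Gen_c # w)) (act g a)) \<oplus>\<^bsub>L\<^esub> V (act (\<lambda>w. f (Gen_v # w)) (act g a)))"
      using fc gc fd g a gd
      by (simp add: D C_add V_add C_smult V_smult smult_assoc1 smult_r_distr M.a_ac)
    also have "\<dots> = act f (act g a)"
      using Suc.prems g a
      by (simp add: act_derivatives[of f "act g a"] act_derivatives[OF g a, symmetric])
    finally show ?case .
  qed
qed


section \<open>Descent of the action to the quotient by the Taft relations\<close>

lemma A_ring: "ring A"
  by (rule ring_free_algebra)

lemma act_mult:
  "\<lbrakk>f \<in> carrier A; g \<in> carrier A; a \<in> carrier L\<rbrakk> \<Longrightarrow> act (f \<otimes>\<^bsub>A\<^esub> g) a = act f (act g a)"
  by (simp add: mult_free_algebra act_convolve)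

lemma act_one: "a \<in> carrier L \<Longrightarrow> act \<one>\<^bsub>A\<^esub> a = a"
  by (simp add: free_algebra_simps act_free_word)

lemma act_add:
  "\<lbrakk>f \<in> carrier A; g \<in> carrier A; a \<in> carrier L\<rbrakk> \<Longrightarrow> act (f \<oplus>\<^bsub>A\<^esub> g) a = act f a \<oplus>\<^bsub>L\<^esub> act g a"
  by (simp add: free_algebra_simps act_add_left)

lemma act_zero: "act \<zero>\<^bsub>A\<^esub> a = \<zero>\<^bsub>L\<^esub>"
  by (simp add: free_algebra_simps)

lemma act_minus:
  assumes "f \<in> carrier A" "g \<in> carrier A" "a \<in> carrier L"
  shows "act (f \<ominus>\<^bsub>A\<^esub> g) a = act f a \<ominus>\<^bsub>L\<^esub> act g a"
proof -
  interpret A: ring A by (rule A_ring)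
  have "act (f \<ominus>\<^bsub>A\<^esub> g) a \<oplus>\<^bsub>L\<^esub> act g a = act f a"
    using assms by (simp add: act_add[symmetric] A.minus_eq A.a_assoc A.l_neg)
  then show ?thesis
    using assms by (metis A.minus_closed M.add.inv_solve_right' M.minus_eq act_closed)
qed

lemma act_pow:
  assumes "f \<in> carrier A" "a \<in> carrier L"
  shows "act (f [^]\<^bsub>A\<^esub> (n::nat)) a = (act f ^^ n) a"
proof -
  interpret A: ring A by (rule A_ring)
  show ?thesis
    using assms(2)
    by (induction n arbitrary: a)
      (use assms(1) in \<open>simp_all add: act_one act_mult funpow_Suc_right del: funpow.simps(2)\<close>)
qed

text \<open>Membership is carried along because \<open>act_free_word\<close> compares the two
  operators only on the carrier.\<close>

lemma funpow_act_free_word: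
  assumes "a \<in> carrier L"
  shows "(act (free_word F w) ^^ n) a = (word_act w ^^ n) a \<and> (word_act w ^^ n) a \<in> carrier L"
  using assms by (induction n) (simp_all add: act_free_word)

lemma taft_relators_carrier: "taft_relators F m \<zeta> \<subseteq> carrier A"
proof -
  interpret A: ring A by (rule A_ring)
  have "\<zeta> \<odot>\<^bsub>A\<^esub> f \<in> carrier A" if "f \<in> carrier A" for f
    using that smult_carrier[of \<zeta> f] by (simp add: free_algebra_simps)
  then show ?thesis
    by (auto simp: taft_relators_def Let_def)
qed

lemma act_taft_relator:
  assumes "r \<in> taft_relators F m \<zeta>" "a \<in> carrier L"
  shows "act r a = \<zero>\<^bsub>L\<^esub>"
proof -
  interpret A: ring A by (rule A_ring)
  have c: "act (free_word F [Gen_c]) b = C b" and v: "act (free_word F [Gen_v]) b = V b"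
    if "b \<in> carrier L" for b
    using that by (simp_all add: act_free_word)
  have sm: "\<zeta> \<odot>\<^bsub>A\<^esub> f \<in> carrier A" "act (\<zeta> \<odot>\<^bsub>A\<^esub> f) a = \<zeta> \<odot>\<^bsub>L\<^esub> act f a" if "f \<in> carrier A" for f
    using that smult_carrier[of \<zeta> f] act_smult_left[of \<zeta> f] assms(2)
    by (simp_all add: free_algebra_simps)
  show ?thesis
    using assms unfolding taft_relators_def Let_def
    by (auto simp: act_minus act_pow act_one act_mult sm funpow_act_free_word C_power V_power c v V_C
        M.r_neg M.minus_eq)
qed

text \<open>The smallest ideal containing the relators lies inside any ideal that contains them, so
  everything in \<open>taft_ideal\<close> acts by zero as soon as the annihilator is known to be an
  ideal.\<close>

lemma annihilator_ideal:
  "ideal {f \<in> carrier A. \<forall>a\<in>carrier L. act f a = \<zero>\<^bsub>L\<^esub>} A" (is "ideal ?J A")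
proof -
  interpret A: ring A by (rule A_ring)
  \<comment> \<open>For a product whose right factor annihilates: the left factor is then applied to
    zero.\<close>
  have zero: "act f \<zero>\<^bsub>L\<^esub> = \<zero>\<^bsub>L\<^esub>" if "f \<in> carrier A" for f
    using act_add_right[OF that, of "\<zero>\<^bsub>L\<^esub>" "\<zero>\<^bsub>L\<^esub>"] act_closed[OF that, of "\<zero>\<^bsub>L\<^esub>"]
    by (simp add: M.add.r_cancel_one')
  have neg: "act (\<ominus>\<^bsub>A\<^esub> f) a = \<ominus>\<^bsub>L\<^esub> act f a" if "f \<in> carrier A" "a \<in> carrier L" for f a
    using act_minus[of "\<zero>\<^bsub>A\<^esub>" f a] that by (simp add: A.minus_eq M.minus_eq act_zero)
  show ?thesis
  proof (rule idealI)
    show "subgroup ?J (add_monoid A)"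
      by (rule A.add.subgroupI) (auto simp: act_add neg intro!: exI[of _ "\<zero>\<^bsub>A\<^esub>"] act_zero)
  qed (auto simp: A_ring act_mult zero)
qed

lemma ideal_taft_ideal: "ideal (taft_ideal F m \<zeta>) A"
  unfolding taft_ideal_def
  by (rule ring.genideal_ideal[OF A_ring taft_relators_carrier])

lemma act_taft_ideal:
  assumes "f \<in> taft_ideal F m \<zeta>" "a \<in> carrier L"
  shows "act f a = \<zero>\<^bsub>L\<^esub>"
proof -
  have "taft_ideal F m \<zeta> \<subseteq> {f \<in> carrier A. \<forall>a\<in>carrier L. act f a = \<zero>\<^bsub>L\<^esub>}"
    unfolding taft_ideal_def
    by (rule ring.genideal_minimal[OF A_ring annihilator_ideal])
      (use taft_relators_carrier act_taft_relator in blast)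
  then show ?thesis using assms by blast
qed

lemma taft_algebra_carrierE:
  assumes "h \<in> carrier (taft_algebra F m \<zeta>)"
  obtains f where "f \<in> carrier A" "h = taft_class F m \<zeta> f"
  using assms by (auto simp: taft_algebra_def taft_class_def FactRing_simps)

lemma taft_class_carrier:
  "f \<in> carrier A \<Longrightarrow> taft_class F m \<zeta> f \<in> carrier (taft_algebra F m \<zeta>)"
  by (auto simp: taft_algebra_def taft_class_def FactRing_simps)

text \<open>Representatives of one coset differ by an element of the Taft ideal, which acts by zero.
  That the image is a singleton is what gives \<open>the_elem\<close> its intended value.\<close>

lemma image_act_taft_class:
  assumes f: "f \<in> carrier A" and a: "a \<in> carrier L"
  shows "(\<lambda>g. act g a) ` taft_class F m \<zeta> f = {act f a}"
proof -
  interpret I: ideal "taft_ideal F m \<zeta>" A by (rule ideal_taft_ideal)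
  have "act g a = act f a" if g: "g \<in> taft_class F m \<zeta> f" for g
  proof -
    from g have "\<exists>h\<in>taft_ideal F m \<zeta>. g = h \<oplus>\<^bsub>A\<^esub> f"
      unfolding taft_class_def a_r_coset_def' by blast
    then obtain h where h: "h \<in> taft_ideal F m \<zeta>" "g = h \<oplus>\<^bsub>A\<^esub> f" ..
    then show ?thesis
      using f a I.Icarr[OF h(1)] by (simp add: act_add act_taft_ideal)
  qed
  then have "(\<lambda>g. act g a) ` taft_class F m \<zeta> f = (\<lambda>g. act f a) ` taft_class F m \<zeta> f"
    by (rule image_cong[OF refl])
  \<comment> \<open>The coset has to be nonempty, since otherwise the image would be empty instead
    of a singleton.\<close>
  also have "f \<in> taft_class F m \<zeta> f"
    unfolding taft_class_def by (rule I.a_rcos_self[OF f])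
  then have "(\<lambda>g. act f a) ` taft_class F m \<zeta> f = {act f a}"
    by (rule image_constant)
  finally show ?thesis .
qed

abbreviation L_taft :: "('f, 'a) taft_lie" where
  "L_taft \<equiv> module.extend L \<lparr>taft_act = (\<lambda>h a. the_elem ((\<lambda>f. act f a) ` h))\<rparr>"

lemma taft_act_class:
  "\<lbrakk>f \<in> carrier A; a \<in> carrier L\<rbrakk> \<Longrightarrow> taft_act L_taft (taft_class F m \<zeta> f) a = act f a"
  by (simp add: module.defs image_act_taft_class)

text \<open>The recursion of \<open>taft_comult\<close> mirrors \<open>C_bracket\<close> and
  \<open>V_bracket\<close>: each letter in front of a word applies one of these rules to every pair
  already present.\<close>

lemma word_act_bracket:
  assumes "a \<in> carrier L" "b \<in> carrier L"
  shows "word_act w (a \<otimes>\<^bsub>L\<^esub> b)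
    = (\<Oplus>\<^bsub>L\<^esub>pq\<in>taft_comult w. word_act (fst pq) a \<otimes>\<^bsub>L\<^esub> word_act (snd pq) b)"
proof (induction w rule: taft_comult.induct)
  case 1
  then show ?case using assms by (simp add: bracket_closed)
next
  case (2 w)
  then show ?case
    using assms
    by (subst taft_comult.simps, subst M.finsum_reindex)
      (auto simp: inj_on_def bracket_closed C_finsum C_bracket case_prod_unfold
        intro!: M.finsum_cong')
next
  case (3 w)
  let ?t = "\<lambda>pq. word_act (fst pq) a \<otimes>\<^bsub>L\<^esub> word_act (snd pq) b"
  let ?l = "\<lambda>(p, q). (Gen_c # p, Gen_v # q)" and ?r = "\<lambda>(p, q). (Gen_v # p, q)"
  have t: "?t pq \<in> carrier L" for pq using assms by (simp add: bracket_closed)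
  \<comment> \<open>The two families of pairs are disjoint: their first components begin with
    different letters.\<close>
  have "finsum L ?t (taft_comult (Gen_v # w))
    = finsum L ?t (?l ` taft_comult w) \<oplus>\<^bsub>L\<^esub> finsum L ?t (?r ` taft_comult w)"
    unfolding taft_comult.simps
    by (rule M.finsum_Un_disjoint) (use t finite_taft_comult in auto)
  also have "\<dots> = finsum L (\<lambda>pq. ?t (?l pq)) (taft_comult w)
      \<oplus>\<^bsub>L\<^esub> finsum L (\<lambda>pq. ?t (?r pq)) (taft_comult w)"
    using t by (intro arg_cong2[of _ _ _ _ "add L"] M.finsum_reindex) (auto simp: inj_on_def)
  also have "\<dots> = finsum L (\<lambda>pq. ?t (?l pq) \<oplus>\<^bsub>L\<^esub> ?t (?r pq)) (taft_comult w)"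
    using t by (intro M.finsum_addf[symmetric]) blast+
  also have "\<dots> = finsum L (\<lambda>pq. V (?t pq)) (taft_comult w)"
    using assms by (intro M.finsum_cong') (auto simp: V_bracket bracket_closed)
  also have "\<dots> = V (finsum L ?t (taft_comult w))"
    using t by (intro V_finsum[symmetric]) auto
  finally show ?case using 3 by simp
qed

lemma lie_algebra_L_taft: "lie_algebra F L_taft"
proof (intro lie_algebra.intro lie_algebra_axioms.intro)
  show "field F" ..
  show "module F L_taft"
  proof (rule moduleI)
    show "cring F" ..
    have "\<exists>b\<in>carrier L. b \<oplus>\<^bsub>L\<^esub> a = \<zero>\<^bsub>L\<^esub>" if "a \<in> carrier L" for a
      using that M.l_neg by blast
    then show "abelian_group L_taft"
      by (intro abelian_groupI) (auto simp: module.defs M.a_ac)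
  qed (auto simp: module.defs smult_l_distr smult_r_distr smult_assoc1)
qed (auto simp: module.defs bracket_closed bracket_l_distr bracket_r_distr bracket_smult_l
    bracket_smult_r bracket_alternating jacobi)

lemma taft_module_lie_algebra_L_taft: "taft_module_lie_algebra F m \<zeta> L_taft"
proof -
  interpret I: ideal "taft_ideal F m \<zeta>" A by (rule ideal_taft_ideal)
  have L_taft_simps: "carrier L_taft = carrier L" "add L_taft = add L" "zero L_taft = zero L"
    "mult L_taft = mult L" "smult L_taft = smult L"
    by (simp_all add: module.defs)
  have finsum_L_taft: "finsum L_taft = finsum L"
    by (rule finsum_cong_ring) (simp_all add: L_taft_simps)
  have class_add: "taft_class F m \<zeta> f \<oplus>\<^bsub>taft_algebra F m \<zeta>\<^esub> taft_class F m \<zeta> g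
      = taft_class F m \<zeta> (f \<oplus>\<^bsub>A\<^esub> g)"
    and class_mult: "taft_class F m \<zeta> f \<otimes>\<^bsub>taft_algebra F m \<zeta>\<^esub> taft_class F m \<zeta> g
      = taft_class F m \<zeta> (f \<otimes>\<^bsub>A\<^esub> g)"
    if "f \<in> carrier A" "g \<in> carrier A" for f g
    using that by (simp_all add: taft_algebra_def taft_class_def FactRing_simps
        I.a_rcos_sum I.rcoset_mult_add)
  show ?thesis
  proof (rule taft_module_lie_algebra.intro[OF lie_algebra_L_taft], rule taft_module_lie_algebra_axioms.intro,
      unfold L_taft_simps finsum_L_taft)
    fix f a b assume *: "f \<in> carrier A" "a \<in> carrier L" "b \<in> carrier L"
    have c: "\<And>w. f w \<in> carrier F" using * by (simp add: carrier_free_algebra)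
    have "taft_act L_taft (taft_class F m \<zeta> f) (a \<otimes>\<^bsub>L\<^esub> b) = act f (a \<otimes>\<^bsub>L\<^esub> b)"
      using * by (simp add: taft_act_class bracket_closed)
    also have "\<dots> = (\<Oplus>\<^bsub>L\<^esub>w\<in>{w. f w \<noteq> \<zero>\<^bsub>F\<^esub>}. f w \<odot>\<^bsub>L\<^esub>
      (\<Oplus>\<^bsub>L\<^esub>pq\<in>taft_comult w. word_act (fst pq) a \<otimes>\<^bsub>L\<^esub> word_act (snd pq) b))"
      unfolding free_act_def using * by (simp add: word_act_bracket)
    also have "\<dots> = (\<Oplus>\<^bsub>L\<^esub>w\<in>{w. f w \<noteq> \<zero>\<^bsub>F\<^esub>}. f w \<odot>\<^bsub>L\<^esub>
            (\<Oplus>\<^bsub>L\<^esub>pq\<in>taft_comult w.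
               taft_act L_taft (taft_class F m \<zeta> (free_word F (fst pq))) a \<otimes>\<^bsub>L\<^esub>
               taft_act L_taft (taft_class F m \<zeta> (free_word F (snd pq))) b))"
      using * by (simp add: taft_act_class act_free_word)
    finally show "taft_act L_taft (taft_class F m \<zeta> f) (a \<otimes>\<^bsub>L\<^esub> b)
      = (\<Oplus>\<^bsub>L\<^esub>w\<in>{w. f w \<noteq> \<zero>\<^bsub>F\<^esub>}. f w \<odot>\<^bsub>L\<^esub>
            (\<Oplus>\<^bsub>L\<^esub>pq\<in>taft_comult w.
               taft_act L_taft (taft_class F m \<zeta> (free_word F (fst pq))) a \<otimes>\<^bsub>L\<^esub>
               taft_act L_taft (taft_class F m \<zeta> (free_word F (snd pq))) b))" .
  next
    fix x a assume *: "x \<in> carrier F" "a \<in> carrier L"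
    have "x \<odot>\<^bsub>A\<^esub> \<one>\<^bsub>A\<^esub> \<in> carrier A"
      using * smult_carrier[of x "free_word F []"] by (simp add: free_algebra_simps)
    then show "taft_act L_taft (taft_class F m \<zeta> (x \<odot>\<^bsub>A\<^esub> \<one>\<^bsub>A\<^esub>)) a = x \<odot>\<^bsub>L\<^esub> a"
      using * by (simp add: taft_act_class) (simp add: free_algebra_simps act_smult_left act_free_word)
  qed (auto elim!: taft_algebra_carrierE
      simp: taft_act_class act_add_right class_add class_mult act_add act_mult)
qed

end


section \<open>Powers of a Lie algebra\<close>

lemma lie_power_simps:
  "carrier (lie_power m B) = {1..m} \<rightarrow>\<^sub>E carrier B"
  "a \<otimes>\<^bsub>lie_power m B\<^esub> b = (\<lambda>i\<in>{1..m}. a i \<otimes>\<^bsub>B\<^esub> b i)"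
  "\<zero>\<^bsub>lie_power m B\<^esub> = (\<lambda>i\<in>{1..m}. \<zero>\<^bsub>B\<^esub>)"
  "a \<oplus>\<^bsub>lie_power m B\<^esub> b = (\<lambda>i\<in>{1..m}. a i \<oplus>\<^bsub>B\<^esub> b i)"
  "x \<odot>\<^bsub>lie_power m B\<^esub> a = (\<lambda>i\<in>{1..m}. x \<odot>\<^bsub>B\<^esub> a i)"
  by (simp_all add: lie_power_def)

lemma lie_power_eqI:
  assumes "a \<in> carrier (lie_power m B)" "b \<in> carrier (lie_power m B)"
    and "\<And>i. i \<in> {1..m} \<Longrightarrow> a i = b i"
  shows "a = b"
  using assms unfolding lie_power_simps by (rule PiE_ext)

lemma cyc_pred_in [simp]: "i \<in> {1..m} \<Longrightarrow> cyc_pred m i \<in> {1..m}"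
  by (auto simp: cyc_pred_def)

lemma (in abelian_group) eq_if_minus_zero:
  assumes "x \<ominus> y = \<zero>" "x \<in> carrier G" "y \<in> carrier G"
  shows "x = y"
  using assms by (metis a_minus_def a_inv_closed minus_equality minus_minus)

lemma (in domain) nat_pow_nonzero:
  assumes "x \<in> carrier R" "x \<noteq> \<zero>"
  shows "x [^] (n::nat) \<noteq> \<zero>"
  by (induction n) (use assms integral[of "x [^] _" x] in auto)

lemma (in domain) finprod_eq_zero_iff:
  assumes "finite J" "f \<in> J \<rightarrow> carrier R"
  shows "finprod R f J = \<zero> \<longleftrightarrow> (\<exists>j\<in>J. f j = \<zero>)"
  using assms
proof (induction J rule: finite_induct)
  case (insert j J)
  then have "f j \<in> carrier R" "f \<in> J \<rightarrow> carrier R" "finprod R f J \<in> carrier R" by auto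
  then show ?case
    using insert integral[of "f j" "finprod R f J"] by auto
qed simp

context lie_algebra
begin

lemma F_group: "abelian_group F" ..

lemmas F_r_neg = abelian_group.r_neg[OF F_group]
lemmas F_eq_if_minus_zero = abelian_group.eq_if_minus_zero[OF F_group]

lemma lie_algebra_lie_power: "lie_algebra F (lie_power m L)"
proof (intro lie_algebra.intro lie_algebra_axioms.intro)
  show "field F" ..
  have "\<exists>b\<in>carrier (lie_power m L). b \<oplus>\<^bsub>lie_power m L\<^esub> a = \<zero>\<^bsub>lie_power m L\<^esub>"
    if a: "a \<in> carrier (lie_power m L)" for a
  proof
    show "(\<lambda>i\<in>{1..m}. \<ominus>\<^bsub>L\<^esub> a i) \<in> carrier (lie_power m L)"
      using a by (auto simp: lie_power_simps PiE_iff)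
    show "(\<lambda>i\<in>{1..m}. \<ominus>\<^bsub>L\<^esub> a i) \<oplus>\<^bsub>lie_power m L\<^esub> a = \<zero>\<^bsub>lie_power m L\<^esub>"
      using a by (auto simp: lie_power_simps PiE_iff M.l_neg intro!: restrict_ext)
  qed
  then have "abelian_group (lie_power m L)"
    by (intro abelian_groupI)
      (auto simp: lie_power_simps PiE_iff M.a_ac extensional_def intro!: restrict_ext)
  moreover have "cring F" ..
  ultimately show "module F (lie_power m L)"
    by (intro moduleI)
      (auto simp: lie_power_simps PiE_iff smult_l_distr smult_r_distr smult_assoc1
        extensional_def intro!: restrict_ext)
qed (auto simp: lie_power_simps PiE_iff bracket_closed bracket_l_distr bracket_r_distr
    bracket_smult_l bracket_smult_r bracket_alternating jacobi intro!: restrict_ext)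

lemma smult_minus_right:
  assumes "x \<in> carrier F" "a \<in> carrier L" "b \<in> carrier L"
  shows "x \<odot>\<^bsub>L\<^esub> (a \<ominus>\<^bsub>L\<^esub> b) = x \<odot>\<^bsub>L\<^esub> a \<ominus>\<^bsub>L\<^esub> x \<odot>\<^bsub>L\<^esub> b"
  using assms by (simp add: M.minus_eq smult_r_distr smult_r_minus)

lemma smult_minus_left:
  assumes "x \<in> carrier F" "y \<in> carrier F" "a \<in> carrier L"
  shows "(x \<ominus>\<^bsub>F\<^esub> y) \<odot>\<^bsub>L\<^esub> a = x \<odot>\<^bsub>L\<^esub> a \<ominus>\<^bsub>L\<^esub> y \<odot>\<^bsub>L\<^esub> a"
  using assms by (simp add: a_minus_def smult_l_distr smult_l_minus)

lemma bracket_zero_left [simp]: "a \<in> carrier L \<Longrightarrow> \<zero>\<^bsub>L\<^esub> \<otimes>\<^bsub>L\<^esub> a = \<zero>\<^bsub>L\<^esub>"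
  using bracket_smult_l[of "\<zero>\<^bsub>F\<^esub>" "\<zero>\<^bsub>L\<^esub>" a] by (simp add: bracket_closed)

lemma bracket_zero_right [simp]: "a \<in> carrier L \<Longrightarrow> a \<otimes>\<^bsub>L\<^esub> \<zero>\<^bsub>L\<^esub> = \<zero>\<^bsub>L\<^esub>"
  using bracket_smult_r[of "\<zero>\<^bsub>F\<^esub>" a "\<zero>\<^bsub>L\<^esub>"] by (simp add: bracket_closed)

lemma bracket_minus_left:
  assumes "a \<in> carrier L" "b \<in> carrier L" "d \<in> carrier L"
  shows "(a \<ominus>\<^bsub>L\<^esub> b) \<otimes>\<^bsub>L\<^esub> d = a \<otimes>\<^bsub>L\<^esub> d \<ominus>\<^bsub>L\<^esub> b \<otimes>\<^bsub>L\<^esub> d"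
proof -
  have "(a \<ominus>\<^bsub>L\<^esub> b) \<otimes>\<^bsub>L\<^esub> d \<oplus>\<^bsub>L\<^esub> b \<otimes>\<^bsub>L\<^esub> d = a \<otimes>\<^bsub>L\<^esub> d"
    using assms by (simp add: bracket_l_distr[symmetric] M.minus_eq M.a_assoc M.l_neg)
  then show ?thesis
    using assms by (metis M.add.inv_solve_right' M.minus_closed M.minus_eq bracket_closed)
qed

lemma bracket_minus_right:
  assumes "a \<in> carrier L" "b \<in> carrier L" "d \<in> carrier L"
  shows "d \<otimes>\<^bsub>L\<^esub> (a \<ominus>\<^bsub>L\<^esub> b) = d \<otimes>\<^bsub>L\<^esub> a \<ominus>\<^bsub>L\<^esub> d \<otimes>\<^bsub>L\<^esub> b"
proof -
  have "d \<otimes>\<^bsub>L\<^esub> (a \<ominus>\<^bsub>L\<^esub> b) \<oplus>\<^bsub>L\<^esub> d \<otimes>\<^bsub>L\<^esub> b = d \<otimes>\<^bsub>L\<^esub> a"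
    using assms by (simp add: bracket_r_distr[symmetric] M.minus_eq M.a_assoc M.l_neg)
  then show ?thesis
    using assms by (metis M.add.inv_solve_right' M.minus_closed M.minus_eq bracket_closed)
qed

end

section \<open>The operators c and v on m-tuples\<close>

locale taft_power = lie_algebra F B
  for F :: "('f, 'r) ring_scheme" (structure) and B :: "('f, 'a, 's) module_scheme" (structure) +
  fixes m :: nat and \<zeta> \<alpha> :: 'f
  assumes m_pos: "1 \<le> m"
    and \<zeta>_root: "primitive_root F m \<zeta>"
    and \<alpha>_closed [simp]: "\<alpha> \<in> carrier F"
begin

abbreviation P :: "('f, nat \<Rightarrow> 'a) module" where
  "P \<equiv> lie_power m B"

abbreviation V :: "(nat \<Rightarrow> 'a) \<Rightarrow> nat \<Rightarrow> 'a" where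
  "V \<equiv> L_v F m \<zeta> \<alpha> B"

lemma \<zeta>_closed [simp]: "\<zeta> \<in> carrier F"
  and \<zeta>_pow_m: "\<zeta> [^]\<^bsub>F\<^esub> m = \<one>\<^bsub>F\<^esub>"
  using \<zeta>_root by (auto simp: primitive_root_def)

lemma coordinate_closed [simp]: "\<lbrakk>a \<in> carrier P; 1 \<le> i; i \<le> m\<rbrakk> \<Longrightarrow> a i \<in> carrier B"
  by (auto simp: lie_power_simps)

lemma pred_closed [simp]: "\<lbrakk>a \<in> carrier P; 1 \<le> i; i \<le> m\<rbrakk> \<Longrightarrow> a (cyc_pred m i) \<in> carrier B"
  using cyc_pred_in[of i m] by simp

lemma L_c_closed: "a \<in> carrier P \<Longrightarrow> L_c m a \<in> carrier P"
  unfolding lie_power_simps L_c_def by (rule restrict_PiE_iff[THEN iffD2]) (use cyc_pred_in in blast)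

lemma L_v_closed:
  assumes "a \<in> carrier P"
  shows "V a \<in> carrier P"
  unfolding lie_power_simps(1) L_v_def
  by (rule restrict_PiE_iff[THEN iffD2]) (use assms in simp)

lemma L_v_add:
  assumes "a \<in> carrier P" "b \<in> carrier P"
  shows "V (a \<oplus>\<^bsub>P\<^esub> b) = V a \<oplus>\<^bsub>P\<^esub> V b"
proof -
  have "a i \<oplus>\<^bsub>B\<^esub> b i \<ominus>\<^bsub>B\<^esub> (a j \<oplus>\<^bsub>B\<^esub> b j) = (a i \<ominus>\<^bsub>B\<^esub> a j) \<oplus>\<^bsub>B\<^esub> (b i \<ominus>\<^bsub>B\<^esub> b j)"
    if "i \<in> {1..m}" "j \<in> {1..m}" for i j
    using that assms by (simp add: M.minus_eq M.minus_add M.a_ac)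
  then show ?thesis
    using assms unfolding L_v_def lie_power_simps(4)
    by (intro restrict_ext) (simp add: smult_r_distr cyc_pred_in[simplified])
qed

lemma L_v_smult:
  assumes "x \<in> carrier F" "a \<in> carrier P"
  shows "V (x \<odot>\<^bsub>P\<^esub> a) = x \<odot>\<^bsub>P\<^esub> V a"
  using assms unfolding L_v_def lie_power_simps(5)
  by (intro restrict_ext)
    (simp add: cyc_pred_in[simplified] smult_minus_right[symmetric] smult_assoc1[symmetric] m_ac)

text \<open>The Leibniz rule for finite differences. In the auxiliary identity the primed elements
  are the coordinates at the cyclic predecessor, so \<open>x'\<close> is a coordinate of
  \<open>L_c m a\<close>.\<close>

lemma L_v_bracket:
  assumes "a \<in> carrier P" "b \<in> carrier P"
  shows "V (a \<otimes>\<^bsub>P\<^esub> b) = L_c m a \<otimes>\<^bsub>P\<^esub> V b \<oplus>\<^bsub>P\<^esub> V a \<otimes>\<^bsub>P\<^esub> b"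
proof -
  have *: "x \<otimes>\<^bsub>B\<^esub> y \<ominus>\<^bsub>B\<^esub> x' \<otimes>\<^bsub>B\<^esub> y' = x' \<otimes>\<^bsub>B\<^esub> (y \<ominus>\<^bsub>B\<^esub> y') \<oplus>\<^bsub>B\<^esub> (x \<ominus>\<^bsub>B\<^esub> x') \<otimes>\<^bsub>B\<^esub> y"
    if "x \<in> carrier B" "y \<in> carrier B" "x' \<in> carrier B" "y' \<in> carrier B" for x y x' y'
  proof -
    have "x' \<otimes>\<^bsub>B\<^esub> (y \<ominus>\<^bsub>B\<^esub> y') \<oplus>\<^bsub>B\<^esub> (x \<ominus>\<^bsub>B\<^esub> x') \<otimes>\<^bsub>B\<^esub> y
      = (x' \<otimes>\<^bsub>B\<^esub> y \<ominus>\<^bsub>B\<^esub> x' \<otimes>\<^bsub>B\<^esub> y') \<oplus>\<^bsub>B\<^esub> (x \<otimes>\<^bsub>B\<^esub> y \<ominus>\<^bsub>B\<^esub> x' \<otimes>\<^bsub>B\<^esub> y)"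
      using that by (simp add: bracket_minus_left bracket_minus_right)
    also have "\<dots> = (x' \<otimes>\<^bsub>B\<^esub> y \<oplus>\<^bsub>B\<^esub> \<ominus>\<^bsub>B\<^esub> (x' \<otimes>\<^bsub>B\<^esub> y)) \<oplus>\<^bsub>B\<^esub> (x \<otimes>\<^bsub>B\<^esub> y \<ominus>\<^bsub>B\<^esub> x' \<otimes>\<^bsub>B\<^esub> y')"
      using that by (simp add: bracket_closed M.minus_eq M.a_ac)
    also have "\<dots> = x \<otimes>\<^bsub>B\<^esub> y \<ominus>\<^bsub>B\<^esub> x' \<otimes>\<^bsub>B\<^esub> y'"
      using that by (simp add: bracket_closed M.r_neg)
    finally show ?thesis ..
  qed
  show ?thesis
    using assms unfolding L_v_def L_c_def lie_power_simps(2,4)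
    by (intro restrict_ext)
      (simp add: cyc_pred_in[simplified] * bracket_closed smult_r_distr bracket_smult_l bracket_smult_r)
qed

text \<open>Away from position 1 this only shifts an exponent; at position 1, where the predecessor
  is \<open>m\<close>, it is \<zeta>^m = 1. It yields the relation vc = \<zeta>cv.\<close>

lemma \<zeta>_pow_cyc_pred:
  assumes "i \<in> {1..m}"
  shows "\<zeta> [^]\<^bsub>F\<^esub> (i - 1) = \<zeta> \<otimes>\<^bsub>F\<^esub> \<zeta> [^]\<^bsub>F\<^esub> (cyc_pred m i - 1)"
proof (cases "i = 1")
  case True
  obtain n where "m = Suc n" using m_pos by (cases m) auto
  with True show ?thesis using \<zeta>_pow_m by (simp add: cyc_pred_def m_comm)
next
  case False
  then obtain n where "i = Suc (Suc n)" using assms by (cases i; cases "i - 1") auto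
  then show ?thesis by (simp add: cyc_pred_def m_comm)
qed

lemma L_v_L_c:
  assumes "a \<in> carrier P"
  shows "V (L_c m a) = \<zeta> \<odot>\<^bsub>P\<^esub> L_c m (V a)"
  unfolding L_v_def L_c_def lie_power_simps(5)
proof (rule restrict_ext, goal_cases)
  case (1 i)
  note e = \<zeta>_pow_cyc_pred[OF 1]
  show ?case
    using 1 assms by (simp add: cyc_pred_in[simplified] e[simplified] smult_assoc1[symmetric] m_ac)
qed

text \<open>The bound on \<open>n\<close> means that indices wrap around at most once; for
  \<open>n = m\<close> every index returns to itself.\<close>

lemma L_c_funpow:
  assumes "a \<in> carrier P" "n \<le> m"
  shows "(L_c m ^^ n) a \<in> carrier P \<and>
    (\<forall>i\<in>{1..m}. (L_c m ^^ n) a i = a (if n < i then i - n else i + m - n))"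
  using assms(2)
proof (induction n)
  case 0
  then show ?case using assms(1) by simp
next
  case (Suc n)
  have "(L_c m ^^ Suc n) a i = a (if Suc n < i then i - Suc n else i + m - Suc n)"
    if i: "i \<in> {1..m}" for i
  proof -
    have "(L_c m ^^ Suc n) a i = (L_c m ^^ n) a (cyc_pred m i)"
      using i by (simp add: L_c_def)
    also have "\<dots> = a (if n < cyc_pred m i then cyc_pred m i - n else cyc_pred m i + m - n)"
      using Suc i by (simp add: cyc_pred_in[simplified])
    also have "(if n < cyc_pred m i then cyc_pred m i - n else cyc_pred m i + m - n)
      = (if Suc n < i then i - Suc n else i + m - Suc n)"
      using i Suc.prems by (auto simp: cyc_pred_def)
    finally show ?thesis .
  qed
  then show ?case using Suc L_c_closed by simp
qed

lemma L_c_power: "a \<in> carrier P \<Longrightarrow> (L_c m ^^ m) a = a"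
  using L_c_funpow[of a m] by (intro lie_power_eqI) auto

section \<open>Nilpotency of v by interpolation\<close>

lemma L_v_funpow_add:
  assumes "a \<in> carrier P" "b \<in> carrier P"
  shows "(V ^^ n) (a \<oplus>\<^bsub>P\<^esub> b) = (V ^^ n) a \<oplus>\<^bsub>P\<^esub> (V ^^ n) b
    \<and> (V ^^ n) a \<in> carrier P \<and> (V ^^ n) b \<in> carrier P"
  using assms by (induction n) (simp_all add: L_v_add L_v_closed)

lemma L_v_funpow_smult:
  assumes "x \<in> carrier F" "a \<in> carrier P"
  shows "(V ^^ n) (x \<odot>\<^bsub>P\<^esub> a) = x \<odot>\<^bsub>P\<^esub> (V ^^ n) a \<and> (V ^^ n) a \<in> carrier P"
  using assms by (induction n) (simp_all add: L_v_smult L_v_closed)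

text \<open>A pure tensor, when tuples are read as scalar functions on the positions tensored with
  \<open>B\<close>. The operator v acts on the scalar function only.\<close>

definition tensor :: "(nat \<Rightarrow> 'f) \<Rightarrow> 'a \<Rightarrow> nat \<Rightarrow> 'a" where
  "tensor f b = (\<lambda>i\<in>{1..m}. f i \<odot>\<^bsub>B\<^esub> b)"

lemma tensor_closed:
  "\<lbrakk>\<And>i. f i \<in> carrier F; b \<in> carrier B\<rbrakk> \<Longrightarrow> tensor f b \<in> carrier P"
  by (simp add: tensor_def lie_power_simps)

text \<open>The diagonal of D as a function of the position. Its powers are eigenfunctions of the
  cyclic shift.\<close>

abbreviation X :: "nat \<Rightarrow> 'f" where
  "X i \<equiv> \<zeta> [^]\<^bsub>F\<^esub> (i - 1)"

text \<open>Here \<zeta>^(m-1) stands for the inverse of \<zeta>: moving to the predecessor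
  multiplies the monomial by its \<open>n\<close>th power. The resulting scalar is attached to
  \<open>b\<close>, so that the image is again a monomial tensor and the formula can be
  iterated.\<close>

lemma L_v_monomial:
  assumes b: "b \<in> carrier B"
  shows "V (tensor (\<lambda>i. X i [^]\<^bsub>F\<^esub> n) b)
    = tensor (\<lambda>i. X i [^]\<^bsub>F\<^esub> Suc n)
        ((\<alpha> \<otimes>\<^bsub>F\<^esub> (\<one>\<^bsub>F\<^esub> \<ominus>\<^bsub>F\<^esub> (\<zeta> [^]\<^bsub>F\<^esub> (m - 1)) [^]\<^bsub>F\<^esub> n)) \<odot>\<^bsub>B\<^esub> b)"
  unfolding L_v_def tensor_def
proof (rule restrict_ext, goal_cases)
  case (1 i)
  let ?w = "\<zeta> [^]\<^bsub>F\<^esub> (m - 1)"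
  have "\<zeta> [^]\<^bsub>F\<^esub> Suc (m - 1) = \<one>\<^bsub>F\<^esub>" using m_pos \<zeta>_pow_m by simp
  then have w: "?w \<otimes>\<^bsub>F\<^esub> \<zeta> = \<one>\<^bsub>F\<^esub>" by simp
  have "X (cyc_pred m i) = (?w \<otimes>\<^bsub>F\<^esub> \<zeta>) \<otimes>\<^bsub>F\<^esub> X (cyc_pred m i)"
    using w by simp
  also have "\<dots> = ?w \<otimes>\<^bsub>F\<^esub> X i"
    unfolding \<zeta>_pow_cyc_pred[OF 1] by (rule m_assoc) simp_all
  finally have p: "X (cyc_pred m i) [^]\<^bsub>F\<^esub> n = ?w [^]\<^bsub>F\<^esub> n \<otimes>\<^bsub>F\<^esub> X i [^]\<^bsub>F\<^esub> n"
    by (simp add: nat_pow_distrib)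
  define x y u where "x = X i" and "y = x [^]\<^bsub>F\<^esub> n" and "u = ?w [^]\<^bsub>F\<^esub> n"
  have c: "x \<in> carrier F" "y \<in> carrier F" "u \<in> carrier F"
    by (simp_all add: x_def y_def u_def)
  have "y \<odot>\<^bsub>B\<^esub> b \<ominus>\<^bsub>B\<^esub> (u \<otimes>\<^bsub>F\<^esub> y) \<odot>\<^bsub>B\<^esub> b = (y \<otimes>\<^bsub>F\<^esub> (\<one>\<^bsub>F\<^esub> \<ominus>\<^bsub>F\<^esub> u)) \<odot>\<^bsub>B\<^esub> b"
  proof -
    have "y \<otimes>\<^bsub>F\<^esub> (\<one>\<^bsub>F\<^esub> \<ominus>\<^bsub>F\<^esub> u) = y \<ominus>\<^bsub>F\<^esub> u \<otimes>\<^bsub>F\<^esub> y"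
      using c by (simp add: a_minus_def r_distr r_minus m_comm)
    then show ?thesis using b c by (simp add: smult_minus_left)
  qed
  then have "\<alpha> \<odot>\<^bsub>B\<^esub> (x \<odot>\<^bsub>B\<^esub> (y \<odot>\<^bsub>B\<^esub> b \<ominus>\<^bsub>B\<^esub> (u \<otimes>\<^bsub>F\<^esub> y) \<odot>\<^bsub>B\<^esub> b))
    = (y \<otimes>\<^bsub>F\<^esub> x) \<odot>\<^bsub>B\<^esub> ((\<alpha> \<otimes>\<^bsub>F\<^esub> (\<one>\<^bsub>F\<^esub> \<ominus>\<^bsub>F\<^esub> u)) \<odot>\<^bsub>B\<^esub> b)"
    using b c by (simp add: smult_assoc1[symmetric] m_ac)
  then show ?case
    using 1 p by (simp add: cyc_pred_in[simplified] x_def y_def u_def)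
qed

lemma tensor_zero: "(\<And>i. f i \<in> carrier F) \<Longrightarrow> tensor f \<zero>\<^bsub>B\<^esub> = \<zero>\<^bsub>P\<^esub>"
  by (simp add: tensor_def lie_power_simps)

lemma L_v_zero: "(V ^^ n) \<zero>\<^bsub>P\<^esub> = \<zero>\<^bsub>P\<^esub>"
proof -
  have "V \<zero>\<^bsub>P\<^esub> = \<zero>\<^bsub>P\<^esub>"
    unfolding L_v_def lie_power_simps
    by (intro restrict_ext) (simp add: cyc_pred_in[simplified] M.minus_eq M.r_neg)
  then show ?thesis by (induction n) simp_all
qed

text \<open>There are \<open>m - n\<close> steps up to degree \<open>m\<close>, and one more meets
  the scalar 1 - 1 = 0. Since the scalars accumulate on \<open>b\<close>, it has to vary in the
  induction.\<close>

lemma L_v_monomial_nilpotent: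
  assumes "n \<le> m" "b \<in> carrier B"
  shows "(V ^^ Suc (m - n)) (tensor (\<lambda>i. X i [^]\<^bsub>F\<^esub> n) b) = \<zero>\<^bsub>P\<^esub>"
  using assms
proof (induction "m - n" arbitrary: n b)
  case 0
  then have n: "n = m" by simp
  have "(\<zeta> [^]\<^bsub>F\<^esub> (m - 1)) [^]\<^bsub>F\<^esub> m = \<one>\<^bsub>F\<^esub>"
    by (metis \<zeta>_closed \<zeta>_pow_m nat_pow_one nat_pow_pow mult.commute)
  then have "V (tensor (\<lambda>i. X i [^]\<^bsub>F\<^esub> m) b) = \<zero>\<^bsub>P\<^esub>"
    unfolding L_v_monomial[OF 0(3)] using 0(3) by (simp add: tensor_zero a_minus_def F_r_neg)
  then show ?case unfolding n by simp
next
  case (Suc d)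
  then have "m - n = Suc (m - Suc n)" "Suc n \<le> m" by auto
  then have "(V ^^ Suc (m - Suc n)) (V (tensor (\<lambda>i. X i [^]\<^bsub>F\<^esub> n) b)) = \<zero>\<^bsub>P\<^esub>"
    unfolding L_v_monomial[OF Suc.prems(2)]
    by (intro Suc.hyps(1)) (use Suc.hyps(2) Suc.prems in auto)
  then show ?case
    unfolding \<open>m - n = Suc (m - Suc n)\<close> by (subst funpow_Suc_right) simp
qed

text \<open>Multiplying by a factor \<open>X - \<zeta>^j\<close> trades one unit of degree, so that monomials of degree
  between \<open>1\<close> and \<open>m\<close> generate all functions on \<open>{1..m}\<close>.\<close>

lemma L_v_product_nilpotent:
  assumes "finite J" "1 \<le> n" "n + card J \<le> m" "b \<in> carrier B"
  shows "(V ^^ m) (tensor (\<lambda>i. X i [^]\<^bsub>F\<^esub> n \<otimes>\<^bsub>F\<^esub> (\<Otimes>\<^bsub>F\<^esub>j\<in>J. X i \<ominus>\<^bsub>F\<^esub> X j)) b) = \<zero>\<^bsub>P\<^esub>"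
  using assms
proof (induction J arbitrary: n rule: finite_induct)
  case empty
  \<comment> \<open>This is where \<open>1 \<le> n\<close> enters: the \<open>Suc (m - n)\<close>
    applications that kill the monomial are then available among \<open>m\<close>, and the remaining
    \<open>n - 1\<close> act on zero.\<close>
  then have "V ^^ m = V ^^ (n - 1 + Suc (m - n))" by simp
  then show ?case
    using empty L_v_monomial_nilpotent[of n b] by (simp only: funpow_add o_apply) (simp add: L_v_zero)
next
  case (insert j J)
  interpret P: lie_algebra F P by (rule lie_algebra_lie_power)
  let ?f = "\<lambda>n i. X i [^]\<^bsub>F\<^esub> (n::nat) \<otimes>\<^bsub>F\<^esub> (\<Otimes>\<^bsub>F\<^esub>j\<in>J. X i \<ominus>\<^bsub>F\<^esub> X j)"
  have f: "?f n i \<in> carrier F" for n i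
    by (intro m_closed finprod_closed) auto
  have pc: "(\<Otimes>\<^bsub>F\<^esub>j\<in>J. X i \<ominus>\<^bsub>F\<^esub> X j) \<in> carrier F" for i
    by (intro finprod_closed) auto
  \<comment> \<open>Multiplying out the new factor leaves two products over \<open>J\<close>, of
    degrees \<open>Suc n\<close> and \<open>n\<close>; both respect the bound on
    \<open>n + card J\<close> because \<open>J\<close> has one element fewer.\<close>
  have "X i [^]\<^bsub>F\<^esub> n \<otimes>\<^bsub>F\<^esub> (\<Otimes>\<^bsub>F\<^esub>j\<in>insert j J. X i \<ominus>\<^bsub>F\<^esub> X j)
    = ?f (Suc n) i \<oplus>\<^bsub>F\<^esub> (\<ominus>\<^bsub>F\<^esub> X j) \<otimes>\<^bsub>F\<^esub> ?f n i" for i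
    using insert.hyps pc
    by (simp add: finprod_insert a_minus_def l_distr r_distr m_ac l_minus r_minus)
  then have split: "tensor (\<lambda>i. X i [^]\<^bsub>F\<^esub> n \<otimes>\<^bsub>F\<^esub> (\<Otimes>\<^bsub>F\<^esub>j\<in>insert j J. X i \<ominus>\<^bsub>F\<^esub> X j)) b
    = tensor (?f (Suc n)) b \<oplus>\<^bsub>P\<^esub> (\<ominus>\<^bsub>F\<^esub> X j) \<odot>\<^bsub>P\<^esub> tensor (?f n) b"
    using f insert.prems
    by (simp add: tensor_def lie_power_simps smult_l_distr smult_assoc1 cong: restrict_cong)
  define s t where "s = tensor (?f (Suc n)) b" and "t = tensor (?f n) b"
  have "(V ^^ m) s = \<zero>\<^bsub>P\<^esub>" "(V ^^ m) t = \<zero>\<^bsub>P\<^esub>"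
    unfolding s_def t_def using insert.IH[of n] insert.IH[of "Suc n"] insert.prems insert.hyps
    by (simp_all del: nat_pow_Suc)
  moreover have "s \<in> carrier P" "t \<in> carrier P"
    unfolding s_def t_def using f insert.prems by (blast intro: tensor_closed)+
  ultimately show ?case
    unfolding split s_def[symmetric] t_def[symmetric]
    by (simp add: L_v_funpow_add L_v_funpow_smult)
qed

end

definition single :: "nat \<Rightarrow> ('f, 'a, 's) module_scheme \<Rightarrow> nat \<Rightarrow> 'a \<Rightarrow> nat \<Rightarrow> 'a" where
  "single m B i b = (\<lambda>k\<in>{1..m}. if k = i then b else \<zero>\<^bsub>B\<^esub>)"

context taft_power
begin

lemma \<zeta>_pow_nonzero: "\<zeta> [^]\<^bsub>F\<^esub> (n::nat) \<noteq> \<zero>\<^bsub>F\<^esub>"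
proof (rule nat_pow_nonzero)
  show "\<zeta> \<noteq> \<zero>\<^bsub>F\<^esub>"
    using \<zeta>_pow_m m_pos by (metis nat_pow_zero one_not_zero not_one_le_zero)
qed simp

text \<open>Two exponents differ by some d with 0 < d < m, and after cancellation \<zeta>^d = 1
  would contradict primitivity. Distinctness of these values is what interpolation needs.\<close>

lemma X_inj:
  assumes "i \<in> {1..m}" "j \<in> {1..m}" "i \<noteq> j"
  shows "X i \<noteq> X j"
proof -
  have nontriv: "\<zeta> [^]\<^bsub>F\<^esub> (k + d) \<noteq> \<zeta> [^]\<^bsub>F\<^esub> k" if "d \<in> {1..<m}" for k d :: nat
  proof
    assume "\<zeta> [^]\<^bsub>F\<^esub> (k + d) = \<zeta> [^]\<^bsub>F\<^esub> k"
    then have *: "\<zeta> [^]\<^bsub>F\<^esub> k \<otimes>\<^bsub>F\<^esub> \<zeta> [^]\<^bsub>F\<^esub> d = \<zeta> [^]\<^bsub>F\<^esub> k \<otimes>\<^bsub>F\<^esub> \<one>\<^bsub>F\<^esub>"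
      by (simp add: nat_pow_mult)
    with \<zeta>_pow_nonzero[of k] have "\<zeta> [^]\<^bsub>F\<^esub> d = \<one>\<^bsub>F\<^esub>"
      by (subst (asm) m_lcancel) auto
    then show False using \<zeta>_root that by (auto simp: primitive_root_def)
  qed
  have *: "X j \<noteq> X i" if "i < j" "1 \<le> i" "j \<le> m" for i j
  proof -
    have "i - 1 + (j - i) = j - 1" "j - i \<in> {1..<m}" using that by auto
    then show ?thesis using nontriv[of "j - i" "i - 1"] by simp
  qed
  show ?thesis
    using *[of i j] *[of j i] assms by (cases i j rule: linorder_cases) auto
qed

lemma single_closed: "b \<in> carrier B \<Longrightarrow> single m B i b \<in> carrier P"
  by (simp add: single_def lie_power_simps)

text \<open>Lagrange interpolation: the product of the \<open>m - 1\<close> factors vanishes at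
  every position except \<open>i\<close>. The extra factor of degree 1 vanishes nowhere and keeps
  all degrees between 1 and \<open>m\<close>, as the product lemma requires.\<close>

lemma L_v_single_nilpotent:
  assumes i: "i \<in> {1..m}" and b: "b \<in> carrier B"
  shows "(V ^^ m) (single m B i b) = \<zero>\<^bsub>P\<^esub>"
proof -
  let ?J = "{1..m} - {i}"
  let ?f = "\<lambda>k. X k [^]\<^bsub>F\<^esub> (1::nat) \<otimes>\<^bsub>F\<^esub> (\<Otimes>\<^bsub>F\<^esub>j\<in>?J. X k \<ominus>\<^bsub>F\<^esub> X j)"
  have c: "?f k \<in> carrier F" for k
    by (intro m_closed finprod_closed) auto
  have "(\<Otimes>\<^bsub>F\<^esub>j\<in>?J. X i \<ominus>\<^bsub>F\<^esub> X j) \<noteq> \<zero>\<^bsub>F\<^esub>"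
    using X_inj i by (subst finprod_eq_zero_iff) (auto dest: F_eq_if_minus_zero)
  with \<zeta>_pow_nonzero[of "i - 1"] have fi: "?f i \<noteq> \<zero>\<^bsub>F\<^esub>"
    using integral[of "X i [^]\<^bsub>F\<^esub> (1::nat)"] by (auto intro!: finprod_closed)
  have fk: "?f k = \<zero>\<^bsub>F\<^esub>" if "k \<in> ?J" for k
  proof -
    have "(\<Otimes>\<^bsub>F\<^esub>j\<in>?J. X k \<ominus>\<^bsub>F\<^esub> X j) = \<zero>\<^bsub>F\<^esub>"
      using that by (subst finprod_eq_zero_iff) (auto intro!: bexI[of _ k] simp: a_minus_def F_r_neg)
    then show ?thesis by simp
  qed
  have u: "?f i \<in> Units F" using fi c by (simp add: field_Units)
  \<comment> \<open>Normalisation: the value of the interpolating function at \<open>i\<close> is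
    divided out of \<open>b\<close>.\<close>
  define b' where "b' = inv\<^bsub>F\<^esub> (?f i) \<odot>\<^bsub>B\<^esub> b"
  have b': "b' \<in> carrier B" "?f i \<odot>\<^bsub>B\<^esub> b' = b"
    unfolding b'_def using b u c by (simp_all add: smult_assoc1[symmetric] Units_inv_closed Units_r_inv)
  have "tensor ?f b' = single m B i b"
    unfolding tensor_def single_def using fk b' by (intro restrict_ext) auto
  moreover have "(V ^^ m) (tensor ?f b') = \<zero>\<^bsub>P\<^esub>"
    by (rule L_v_product_nilpotent) (use i b' in auto)
  ultimately show ?thesis by simp
qed

lemma L_v_power:
  assumes a: "a \<in> carrier P"
  shows "(V ^^ m) a = \<zero>\<^bsub>P\<^esub>"
proof -
  interpret P: lie_algebra F P by (rule lie_algebra_lie_power)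
  \<comment> \<open>Truncations of \<open>a\<close>: passing from \<open>n\<close> to
    \<open>Suc n\<close> adds one concentrated tuple, so additivity finishes by induction.\<close>
  define t where "t n = (\<lambda>i\<in>{1..m}. if i \<le> n then a i else \<zero>\<^bsub>B\<^esub>)" for n
  have t: "t n \<in> carrier P" for n using a by (simp add: t_def lie_power_simps PiE_iff)
  have "(V ^^ m) (t n) = \<zero>\<^bsub>P\<^esub>" if "n \<le> m" for n
    using that
  proof (induction n)
    case 0
    have "t 0 = \<zero>\<^bsub>P\<^esub>" by (auto simp: t_def lie_power_simps intro!: restrict_ext)
    then show ?case by (simp only: L_v_zero)
  next
    case (Suc n)
    have an: "a (Suc n) \<in> carrier B" using a Suc.prems by simp
    have "t (Suc n) = t n \<oplus>\<^bsub>P\<^esub> single m B (Suc n) (a (Suc n))"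
      using a an Suc.prems unfolding t_def single_def lie_power_simps(4)
      by (intro restrict_ext) (auto simp: le_Suc_eq)
    with Suc an show ?case
      using L_v_funpow_add[OF t single_closed[OF an], of m n] L_v_single_nilpotent[of "Suc n" "a (Suc n)"]
      by simp
  qed
  from this[of m] have "(V ^^ m) (t m) = \<zero>\<^bsub>P\<^esub>" by simp
  moreover have "t m = a"
    by (rule lie_power_eqI[OF t a]) (simp add: t_def)
  ultimately show ?thesis by simp
qed

sublocale taft_operators F P m \<zeta> "L_c m" V
proof (intro taft_operators.intro taft_operators_axioms.intro lie_algebra_lie_power)
  show "L_c m (a \<oplus>\<^bsub>P\<^esub> b) = L_c m a \<oplus>\<^bsub>P\<^esub> L_c m b" "L_c m (a \<otimes>\<^bsub>P\<^esub> b) = L_c m a \<otimes>\<^bsub>P\<^esub> L_c m b"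
    "L_c m (x \<odot>\<^bsub>P\<^esub> a) = x \<odot>\<^bsub>P\<^esub> L_c m a" for a b x
    by (auto simp: L_c_def lie_power_simps cyc_pred_in[simplified] intro!: restrict_ext)
qed (simp_all add: L_c_closed L_v_closed L_v_add L_v_smult L_v_bracket L_c_power L_v_power L_v_L_c)

end


section \<open>Isomorphisms of powers of simple Lie algebras\<close>

lemma lie_isoD:
  assumes "\<phi> \<in> lie_iso F L M"
  shows "bij_betw \<phi> (carrier L) (carrier M)"
    and "\<And>a. a \<in> carrier L \<Longrightarrow> \<phi> a \<in> carrier M"
    and "\<And>a b. \<lbrakk>a \<in> carrier L; b \<in> carrier L\<rbrakk> \<Longrightarrow> \<phi> (a \<oplus>\<^bsub>L\<^esub> b) = \<phi> a \<oplus>\<^bsub>M\<^esub> \<phi> b"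
    and "\<And>x a. \<lbrakk>x \<in> carrier F; a \<in> carrier L\<rbrakk> \<Longrightarrow> \<phi> (x \<odot>\<^bsub>L\<^esub> a) = x \<odot>\<^bsub>M\<^esub> \<phi> a"
    and "\<And>a b. \<lbrakk>a \<in> carrier L; b \<in> carrier L\<rbrakk> \<Longrightarrow> \<phi> (a \<otimes>\<^bsub>L\<^esub> b) = \<phi> a \<otimes>\<^bsub>M\<^esub> \<phi> b"
  using assms bij_betwE[of \<phi> "carrier L" "carrier M"] by (auto simp: lie_iso_def)

lemma lie_iso_inv:
  assumes "lie_algebra F L" "\<phi> \<in> lie_iso F L M"
  shows "inv_into (carrier L) \<phi> \<in> lie_iso F M L"
proof -
  interpret L: lie_algebra F L by fact
  note \<phi> = lie_isoD[OF assms(2)]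
  let ?g = "inv_into (carrier L) \<phi>"
  have g: "?g y \<in> carrier L" "\<phi> (?g y) = y" if "y \<in> carrier M" for y
    using that \<phi>(1) by (auto simp: bij_betw_def inv_into_into f_inv_into_f)
  have eq: "?g y = a" if "a \<in> carrier L" "\<phi> a = y" for y a
    using that \<phi>(1) by (auto simp: bij_betw_def inv_into_f_f)
  show ?thesis
    unfolding lie_iso_def
    using bij_betw_inv_into[OF \<phi>(1)] g
    by (auto intro!: eq simp: \<phi> L.bracket_closed)
qed

lemma lie_iso_minus:
  assumes "lie_algebra F L" "lie_algebra F M" "\<phi> \<in> lie_iso F L M"
    and "a \<in> carrier L" "b \<in> carrier L"
  shows "\<phi> (a \<ominus>\<^bsub>L\<^esub> b) = \<phi> a \<ominus>\<^bsub>M\<^esub> \<phi> b"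
proof -
  interpret L: lie_algebra F L by fact
  interpret M: lie_algebra F M by fact
  note \<phi> = lie_isoD[OF assms(3)]
  have "\<phi> (a \<ominus>\<^bsub>L\<^esub> b) \<oplus>\<^bsub>M\<^esub> \<phi> b = \<phi> a"
    using assms(4,5)
    by (simp add: \<phi>(3)[symmetric] L.M.minus_eq L.M.a_assoc L.M.l_neg)
  then show ?thesis
    using assms(4,5) \<phi>(2) by (metis M.M.add.inv_solve_right' M.M.minus_eq L.M.minus_closed)
qed

lemma lie_iso_zero:
  assumes "lie_algebra F L" "lie_algebra F M" "\<phi> \<in> lie_iso F L M"
  shows "\<phi> \<zero>\<^bsub>L\<^esub> = \<zero>\<^bsub>M\<^esub>"
proof -
  interpret L: lie_algebra F L by fact
  interpret M: lie_algebra F M by fact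
  note \<phi> = lie_isoD[OF assms(3)]
  have "\<phi> \<zero>\<^bsub>L\<^esub> \<oplus>\<^bsub>M\<^esub> \<phi> \<zero>\<^bsub>L\<^esub> = \<phi> \<zero>\<^bsub>L\<^esub>"
    using \<phi>(3)[of "\<zero>\<^bsub>L\<^esub>" "\<zero>\<^bsub>L\<^esub>"] by simp
  then show ?thesis using \<phi>(2)[of "\<zero>\<^bsub>L\<^esub>"] by (simp add: M.M.add.r_cancel_one')
qed

lemma lie_iso_eq_zero:
  assumes "lie_algebra F L" "lie_algebra F M" "\<phi> \<in> lie_iso F L M" "a \<in> carrier L"
  shows "\<phi> a = \<zero>\<^bsub>M\<^esub> \<longleftrightarrow> a = \<zero>\<^bsub>L\<^esub>"
proof -
  interpret L: lie_algebra F L by fact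
  show ?thesis
    using lie_isoD(1)[OF assms(3)] lie_iso_zero[OF assms(1-3)] assms(4)
    by (metis L.M.zero_closed bij_betw_def inj_on_def)
qed

section \<open>Ideals and copies in a power\<close>

context lie_algebra
begin

lemma lie_idealI:
  assumes "I \<subseteq> carrier L" "\<zero>\<^bsub>L\<^esub> \<in> I" "\<And>a b. \<lbrakk>a \<in> I; b \<in> I\<rbrakk> \<Longrightarrow> a \<oplus>\<^bsub>L\<^esub> b \<in> I"
    and smult: "\<And>x a. \<lbrakk>x \<in> carrier F; a \<in> I\<rbrakk> \<Longrightarrow> x \<odot>\<^bsub>L\<^esub> a \<in> I"
    and "\<And>a b. \<lbrakk>a \<in> carrier L; b \<in> I\<rbrakk> \<Longrightarrow> a \<otimes>\<^bsub>L\<^esub> b \<in> I"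
  shows "lie_ideal I F L"
proof -
  have "\<ominus>\<^bsub>L\<^esub> a \<in> I" if "a \<in> I" for a
    using smult[of "\<ominus>\<^bsub>F\<^esub> \<one>\<^bsub>F\<^esub>" a] that assms(1) by (auto simp: smult_l_minus)
  then show ?thesis
    unfolding lie_ideal_def using assms by (auto intro!: submoduleI)
qed

lemma lie_idealD:
  assumes "lie_ideal I F L"
  shows "I \<subseteq> carrier L" "\<zero>\<^bsub>L\<^esub> \<in> I" "\<And>a b. \<lbrakk>a \<in> I; b \<in> I\<rbrakk> \<Longrightarrow> a \<oplus>\<^bsub>L\<^esub> b \<in> I"
    and "\<And>x a. \<lbrakk>x \<in> carrier F; a \<in> I\<rbrakk> \<Longrightarrow> x \<odot>\<^bsub>L\<^esub> a \<in> I"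
    and "\<And>a b. \<lbrakk>a \<in> carrier L; b \<in> I\<rbrakk> \<Longrightarrow> a \<otimes>\<^bsub>L\<^esub> b \<in> I"
proof -
  interpret submodule I F L using assms by (simp add: lie_ideal_def)
  show "I \<subseteq> carrier L" "\<zero>\<^bsub>L\<^esub> \<in> I" "\<And>a b. \<lbrakk>a \<in> I; b \<in> I\<rbrakk> \<Longrightarrow> a \<oplus>\<^bsub>L\<^esub> b \<in> I"
    "\<And>x a. \<lbrakk>x \<in> carrier F; a \<in> I\<rbrakk> \<Longrightarrow> x \<odot>\<^bsub>L\<^esub> a \<in> I"
    \<comment> \<open>A submodule is a subgroup of the additive group, so \<open>one_closed\<close>
      and \<open>m_closed\<close> speak of zero and addition.\<close>
    using subset one_closed m_closed smult_closed by auto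
  show "\<And>a b. \<lbrakk>a \<in> carrier L; b \<in> I\<rbrakk> \<Longrightarrow> a \<otimes>\<^bsub>L\<^esub> b \<in> I"
    using assms by (simp add: lie_ideal_def)
qed

lemma smult_eq_zero:
  assumes "x \<in> carrier F" "a \<in> carrier L" "x \<odot>\<^bsub>L\<^esub> a = \<zero>\<^bsub>L\<^esub>" "a \<noteq> \<zero>\<^bsub>L\<^esub>"
  shows "x = \<zero>\<^bsub>F\<^esub>"
proof (rule ccontr)
  assume "x \<noteq> \<zero>\<^bsub>F\<^esub>"
  then have u: "x \<in> Units F" using assms(1) by (simp add: field_Units)
  then have "a = inv\<^bsub>F\<^esub> x \<odot>\<^bsub>L\<^esub> (x \<odot>\<^bsub>L\<^esub> a)"
    using assms(1,2) by (simp add: smult_assoc1[symmetric] Units_inv_closed Units_l_inv)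
  with u assms(3,4) show False by (simp add: Units_inv_closed)
qed

lemma single_carrier: "b \<in> carrier L \<Longrightarrow> single m L i b \<in> carrier (lie_power m L)"
  by (simp add: single_def lie_power_simps)

lemma single_add:
  "\<lbrakk>a \<in> carrier L; b \<in> carrier L\<rbrakk>
    \<Longrightarrow> single m L i (a \<oplus>\<^bsub>L\<^esub> b) = single m L i a \<oplus>\<^bsub>lie_power m L\<^esub> single m L i b"
  by (auto simp: single_def lie_power_simps intro!: restrict_ext)

lemma single_smult:
  "\<lbrakk>x \<in> carrier F; b \<in> carrier L\<rbrakk>
    \<Longrightarrow> single m L i (x \<odot>\<^bsub>L\<^esub> b) = x \<odot>\<^bsub>lie_power m L\<^esub> single m L i b"
  by (auto simp: single_def lie_power_simps intro!: restrict_ext)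

lemma bracket_single:
  "\<lbrakk>a \<in> carrier (lie_power m L); b \<in> carrier L\<rbrakk>
    \<Longrightarrow> a \<otimes>\<^bsub>lie_power m L\<^esub> single m L i b = single m L i (a i \<otimes>\<^bsub>L\<^esub> b)"
  by (auto simp: single_def lie_power_simps PiE_iff intro!: restrict_ext)

lemma single_bracket:
  "\<lbrakk>a \<in> carrier (lie_power m L); b \<in> carrier L\<rbrakk>
    \<Longrightarrow> single m L i b \<otimes>\<^bsub>lie_power m L\<^esub> a = single m L i (b \<otimes>\<^bsub>L\<^esub> a i)"
  by (auto simp: single_def lie_power_simps PiE_iff intro!: restrict_ext)

lemma single_zero: "single m L i \<zero>\<^bsub>L\<^esub> = \<zero>\<^bsub>lie_power m L\<^esub>"
  by (auto simp: single_def lie_power_simps)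

lemma single_at [simp]: "i \<in> {1..m} \<Longrightarrow> single m L i b i = b"
  by (simp add: single_def)

lemma single_eq_zero:
  "\<lbrakk>i \<in> {1..m}; single m L i b = \<zero>\<^bsub>lie_power m L\<^esub>\<rbrakk> \<Longrightarrow> b = \<zero>\<^bsub>L\<^esub>"
  by (drule fun_cong[of _ _ i]) (simp add: lie_power_simps single_def)

lemma lie_ideal_copy:
  assumes "i \<in> {1..m}"
  shows "lie_ideal (single m L i ` carrier L) F (lie_power m L)"
proof -
  interpret P: lie_algebra F "lie_power m L" by (rule lie_algebra_lie_power)
  show ?thesis
  proof (rule P.lie_idealI)
    show "\<zero>\<^bsub>lie_power m L\<^esub> \<in> single m L i ` carrier L"
      using single_zero by (metis M.zero_closed imageI)
    fix a b assume "a \<in> carrier (lie_power m L)" "b \<in> single m L i ` carrier L"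
    then show "a \<otimes>\<^bsub>lie_power m L\<^esub> b \<in> single m L i ` carrier L"
      using assms by (auto simp: bracket_single bracket_closed lie_power_simps(1) PiE_iff)
  qed (auto simp: single_carrier single_add[symmetric] single_smult[symmetric])
qed

end

lemma lie_ideal_image:
  assumes "lie_algebra F L" "lie_algebra F M" "\<phi> \<in> lie_iso F L M" "lie_ideal I F L"
  shows "lie_ideal (\<phi> ` I) F M"
proof -
  interpret L: lie_algebra F L by fact
  interpret M: lie_algebra F M by fact
  note \<phi> = lie_isoD[OF assms(3)]
  note I = L.lie_idealD[OF assms(4)]
  have sub: "a \<in> carrier L" if "a \<in> I" for a using I(1) that by auto
  show ?thesis
  proof (rule M.lie_idealI)
    show "\<phi> ` I \<subseteq> carrier M" using \<phi>(2) sub by auto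
    show "\<zero>\<^bsub>M\<^esub> \<in> \<phi> ` I" using I(2) lie_iso_zero[OF assms(1-3)] by (metis imageI)
    show "a \<oplus>\<^bsub>M\<^esub> b \<in> \<phi> ` I" if "a \<in> \<phi> ` I" "b \<in> \<phi> ` I" for a b
      using that I(3) \<phi>(3) sub by (smt (verit, best) image_iff)
    show "x \<odot>\<^bsub>M\<^esub> a \<in> \<phi> ` I" if "x \<in> carrier F" "a \<in> \<phi> ` I" for x a
      using that I(4) \<phi>(4) sub by (smt (verit, best) image_iff)
    show "a \<otimes>\<^bsub>M\<^esub> b \<in> \<phi> ` I" if a: "a \<in> carrier M" and b: "b \<in> \<phi> ` I" for a b
    proof -
      \<comment> \<open>Surjectivity is essential for the absorption property: an arbitrary element
        of \<open>M\<close> must come from \<open>L\<close>.\<close>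
      have "a \<in> \<phi> ` carrier L" using a \<phi>(1) by (simp add: bij_betw_def)
      with b obtain a' b' where "a = \<phi> a'" "a' \<in> carrier L" "b = \<phi> b'" "b' \<in> I" by blast
      then show ?thesis using I(5)[of a' b'] \<phi>(5)[of a' b'] sub by (metis imageI)
    qed
  qed
qed

context simple_lie_algebra
begin

text \<open>The centre is an ideal, and it is not everything because some bracket is
  nonzero.\<close>

lemma center_trivial:
  assumes "x \<in> carrier L" "\<And>y. y \<in> carrier L \<Longrightarrow> y \<otimes>\<^bsub>L\<^esub> x = \<zero>\<^bsub>L\<^esub>"
  shows "x = \<zero>\<^bsub>L\<^esub>"
proof -
  let ?Z = "{x \<in> carrier L. \<forall>y\<in>carrier L. y \<otimes>\<^bsub>L\<^esub> x = \<zero>\<^bsub>L\<^esub>}"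
  have "lie_ideal ?Z F L"
    by (rule lie_idealI) (auto simp: bracket_r_distr bracket_smult_r)
  then have "?Z = {\<zero>\<^bsub>L\<^esub>} \<or> ?Z = carrier L" by (rule no_proper_ideals)
  moreover have "?Z \<noteq> carrier L" using not_abelian by blast
  ultimately have "?Z = {\<zero>\<^bsub>L\<^esub>}" by blast
  moreover have "x \<in> ?Z" using assms by blast
  ultimately show ?thesis by blast
qed

lemma exists_nonzero: "\<exists>x\<in>carrier L. x \<noteq> \<zero>\<^bsub>L\<^esub>"
  using not_abelian bracket_closed by blast

text \<open>Bracketing \<open>x\<close> with an element placed at position \<open>i\<close> erases
  all other coordinates and stays in \<open>I\<close>. Trivial centre lets the remaining coordinate
  be chosen nonzero, and simplicity spreads it over the whole copy.\<close>

lemma ideal_contains_copy: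
  assumes I: "lie_ideal I F (lie_power m L)" and x: "x \<in> I" and i: "i \<in> {1..m}"
    and xi: "x i \<noteq> \<zero>\<^bsub>L\<^esub>"
  shows "single m L i ` carrier L \<subseteq> I"
proof -
  interpret P: lie_algebra F "lie_power m L" by (rule lie_algebra_lie_power)
  note D = P.lie_idealD[OF I]
  let ?J = "{b \<in> carrier L. single m L i b \<in> I}"
  have xP: "x \<in> carrier (lie_power m L)"
    using D(1) x by blast
  then have xi_carrier: "x i \<in> carrier L"
    using i by (auto simp: lie_power_simps(1))
  have "lie_ideal ?J F L"
  proof (rule lie_idealI)
    fix a b assume ab: "a \<in> carrier L" "b \<in> ?J"
    have "single m L i a \<otimes>\<^bsub>lie_power m L\<^esub> single m L i b = single m L i (a \<otimes>\<^bsub>L\<^esub> b)"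
      using ab i by (simp add: bracket_single single_carrier)
    with D(5)[of "single m L i a" "single m L i b"] ab
    show "a \<otimes>\<^bsub>L\<^esub> b \<in> ?J" by (simp add: single_carrier bracket_closed)
  qed (use D in \<open>auto simp: single_zero single_add single_smult\<close>)
  then have "?J = {\<zero>\<^bsub>L\<^esub>} \<or> ?J = carrier L" by (rule no_proper_ideals)
  moreover have "?J \<noteq> {\<zero>\<^bsub>L\<^esub>}"
  proof -
    obtain y where y: "y \<in> carrier L" "y \<otimes>\<^bsub>L\<^esub> x i \<noteq> \<zero>\<^bsub>L\<^esub>"
      using center_trivial xi_carrier xi by blast
    have "single m L i y \<otimes>\<^bsub>lie_power m L\<^esub> x \<in> I"
      using D(5) x y by (simp add: single_carrier)
    then have "y \<otimes>\<^bsub>L\<^esub> x i \<in> ?J"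
      using y xP xi_carrier by (simp add: single_bracket bracket_closed)
    with y show ?thesis by blast
  qed
  ultimately have "?J = carrier L" by blast
  then show ?thesis by blast
qed

lemma nonzero_ideal_contains_copy:
  assumes I: "lie_ideal I F (lie_power m L)" and "x \<in> I" "x \<noteq> \<zero>\<^bsub>lie_power m L\<^esub>"
  shows "\<exists>i\<in>{1..m}. single m L i ` carrier L \<subseteq> I"
proof -
  interpret P: lie_algebra F "lie_power m L" by (rule lie_algebra_lie_power)
  have "x \<in> carrier (lie_power m L)" using P.lie_idealD(1)[OF I] assms(2) by auto
  then have "\<exists>i\<in>{1..m}. x i \<noteq> \<zero>\<^bsub>L\<^esub>"
    using assms(3) lie_power_eqI[of x m L "\<zero>\<^bsub>lie_power m L\<^esub>"] by (auto simp: lie_power_simps)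
  then show ?thesis using ideal_contains_copy[OF I assms(2)] by blast
qed

end

text \<open>The minimal ideals of a power of a simple algebra are its copies, so an isomorphism
  permutes the copies.\<close>

lemma lie_iso_copy:
  assumes "simple_lie_algebra F B\<^sub>1" "simple_lie_algebra F B\<^sub>2"
    and \<theta>: "\<theta> \<in> lie_iso F (lie_power m B\<^sub>1) (lie_power m B\<^sub>2)" and j: "j \<in> {1..m}"
  shows "\<exists>i\<in>{1..m}. \<theta> ` single m B\<^sub>1 i ` carrier B\<^sub>1 = single m B\<^sub>2 j ` carrier B\<^sub>2"
proof -
  interpret B1: simple_lie_algebra F B\<^sub>1 by fact
  interpret B2: simple_lie_algebra F B\<^sub>2 by fact
  let ?P1 = "lie_power m B\<^sub>1" and ?P2 = "lie_power m B\<^sub>2"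
  let ?C1 = "\<lambda>i. single m B\<^sub>1 i ` carrier B\<^sub>1" and ?C2 = "\<lambda>i. single m B\<^sub>2 i ` carrier B\<^sub>2"
  let ?g = "inv_into (carrier ?P1) \<theta>"
  have P1: "lie_algebra F ?P1" and P2: "lie_algebra F ?P2"
    by (rule B1.lie_algebra_lie_power B2.lie_algebra_lie_power)+
  note \<theta>D = lie_isoD[OF \<theta>]
  have g: "?g \<in> lie_iso F ?P2 ?P1" by (rule lie_iso_inv[OF P1 \<theta>])
  have \<theta>g: "\<theta> (?g y) = y" if "y \<in> carrier ?P2" for y
    using that \<theta>D(1) by (simp add: bij_betw_def f_inv_into_f)
  obtain y where y: "y \<in> carrier B\<^sub>2" "y \<noteq> \<zero>\<^bsub>B\<^sub>2\<^esub>" using B2.exists_nonzero by blast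
  let ?y = "single m B\<^sub>2 j y"
  have "?y \<noteq> \<zero>\<^bsub>?P2\<^esub>" using B2.single_eq_zero[OF j] y(2) by blast
  then have nz: "?g ?y \<noteq> \<zero>\<^bsub>?P1\<^esub>"
    using lie_iso_eq_zero[OF P2 P1 g B2.single_carrier[OF y(1)]] by blast
  \<comment> \<open>The preimage of the \<open>j\<close>th copy is a nonzero ideal, so it contains
    some copy of \<open>B\<^sub>1\<close>.\<close>
  have "\<exists>i\<in>{1..m}. ?C1 i \<subseteq> ?g ` ?C2 j"
    by (rule B1.nonzero_ideal_contains_copy[OF _ _ nz])
      (intro lie_ideal_image[OF P2 P1 g] B2.lie_ideal_copy[OF j] imageI y(1))+
  then obtain i where i: "i \<in> {1..m}" "?C1 i \<subseteq> ?g ` ?C2 j" by (rule bexE)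
  have sub: "\<theta> ` ?C1 i \<subseteq> ?C2 j"
  proof (rule image_subsetI)
    fix w assume "w \<in> ?C1 i"
    then have "w \<in> ?g ` ?C2 j" using i(2) by (rule rev_subsetD)
    then obtain b where b: "b \<in> carrier B\<^sub>2" "w = ?g (single m B\<^sub>2 j b)" by blast
    then show "\<theta> w \<in> ?C2 j" using \<theta>g[OF B2.single_carrier[OF b(1)]] by (metis imageI)
  qed
  obtain x where x: "x \<in> carrier B\<^sub>1" "x \<noteq> \<zero>\<^bsub>B\<^sub>1\<^esub>" using B1.exists_nonzero by blast
  let ?x = "single m B\<^sub>1 i x"
  have "?x \<noteq> \<zero>\<^bsub>?P1\<^esub>" using B1.single_eq_zero[OF i(1)] x(2) by blast
  then have nz: "\<theta> ?x \<noteq> \<zero>\<^bsub>?P2\<^esub>"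
    using lie_iso_eq_zero[OF P1 P2 \<theta> B1.single_carrier[OF x(1)]] by blast
  \<comment> \<open>The reverse inclusion: the image of that copy contains a copy in turn, with an
    index \<open>j'\<close> not yet known. It lies in the \<open>j\<close>th copy, and copies with
    different indices share only zero.\<close>
  have "\<exists>j'\<in>{1..m}. ?C2 j' \<subseteq> \<theta> ` ?C1 i"
    by (rule B2.nonzero_ideal_contains_copy[OF _ _ nz])
      (intro lie_ideal_image[OF P1 P2 \<theta>] B1.lie_ideal_copy[OF i(1)] imageI x(1))+
  then obtain j' where j': "j' \<in> {1..m}" "?C2 j' \<subseteq> \<theta> ` ?C1 i" by (rule bexE)
  have "single m B\<^sub>2 j' y \<in> ?C2 j" using sub j'(2) y(1) by blast
  then obtain z where z: "single m B\<^sub>2 j' y = single m B\<^sub>2 j z" by blast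
  have "j' = j"
  proof (rule ccontr)
    assume "j' \<noteq> j"
    with j'(1) fun_cong[OF z, of j'] have "y = \<zero>\<^bsub>B\<^sub>2\<^esub>" by (simp add: single_def)
    with y(2) show False by contradiction
  qed
  with sub j'(2) have "\<theta> ` ?C1 i = ?C2 j" by blast
  with i(1) show ?thesis ..
qed


section \<open>The cyclic shift and its parameter\<close>

lemma (in lie_algebra) minus_zero: "a \<in> carrier L \<Longrightarrow> a \<ominus>\<^bsub>L\<^esub> \<zero>\<^bsub>L\<^esub> = a"
  using M.r_neg[of "\<zero>\<^bsub>L\<^esub>"] by (simp add: M.minus_eq)

text \<open>The position from which coordinate \<open>i\<close> of the image is read.\<close>

definition rot :: "nat \<Rightarrow> nat \<Rightarrow> nat \<Rightarrow> nat" where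
  "rot m k i = (if i \<le> m - k then k + i else i - (m - k))"

lemma rot_in: "\<lbrakk>k < m; i \<in> {1..m}\<rbrakk> \<Longrightarrow> rot m k i \<in> {1..m}"
  by (auto simp: rot_def)

text \<open>This makes reading coordinates through \<open>rot\<close> compatible with c, and with
  the differences in v.\<close>

lemma rot_cyc_pred: "\<lbrakk>k < m; i \<in> {1..m}\<rbrakk> \<Longrightarrow> rot m k (cyc_pred m i) = cyc_pred m (rot m k i)"
  by (auto simp: rot_def cyc_pred_def)

lemma rot_surj:
  assumes "k < m" "i \<in> {1..m}"
  shows "\<exists>j\<in>{1..m}. rot m k j = i"
  using assms
  by (intro bexI[of _ "if k < i then i - k else i + (m - k)"]) (auto simp: rot_def)

lemma rot_inj:
  assumes "k < m"
  shows "inj_on (rot m k) {1..m}"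
proof (rule eq_card_imp_inj_on)
  have "rot m k ` {1..m} = {1..m}"
    using rot_in[OF assms] rot_surj[OF assms] by fast
  then show "card (rot m k ` {1..m}) = card {1..m}" by (rule arg_cong)
qed simp

lemma rot_Suc:
  "\<lbrakk>k < m; 1 \<le> i; Suc i \<le> m\<rbrakk>
    \<Longrightarrow> rot m k (Suc i) = (if rot m k i = m then 1 else Suc (rot m k i))"
  by (auto simp: rot_def Suc_diff_le)

text \<open>Ideals are used for the first coordinate only. A tuple rotated by c brings any other
  coordinate there, so the same \<psi> appears in all of them.\<close>

theorem lie_iso_power_shift:
  assumes B1: "simple_lie_algebra F B\<^sub>1" and B2: "simple_lie_algebra F B\<^sub>2" and m: "1 \<le> m"
    and \<theta>: "\<theta> \<in> lie_iso F (lie_power m B\<^sub>1) (lie_power m B\<^sub>2)"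
    and shift: "\<And>a. a \<in> carrier (lie_power m B\<^sub>1) \<Longrightarrow> \<theta> (L_c m a) = L_c m (\<theta> a)"
  shows "\<exists>k \<psi>. k < m \<and> \<psi> \<in> lie_iso F B\<^sub>1 B\<^sub>2 \<and>
    (\<forall>b\<in>carrier (lie_power m B\<^sub>1). \<forall>i\<in>{1..m}. \<theta> b i = \<psi> (b (rot m k i)))"
proof -
  interpret B1: simple_lie_algebra F B\<^sub>1 by fact
  interpret B2: simple_lie_algebra F B\<^sub>2 by fact
  let ?P1 = "lie_power m B\<^sub>1" and ?P2 = "lie_power m B\<^sub>2"
  have P1: "lie_algebra F ?P1" and P2: "lie_algebra F ?P2"
    by (rule B1.lie_algebra_lie_power B2.lie_algebra_lie_power)+
  interpret P1: lie_algebra F ?P1 by (rule P1)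
  interpret P2: lie_algebra F ?P2 by (rule P2)
  note \<theta>D = lie_isoD[OF \<theta>]
  have one: "1 \<in> {1..m}" using m by simp
  have co1: "b i \<in> carrier B\<^sub>1" if "b \<in> carrier ?P1" "i \<in> {1..m}" for b i
    using that by (auto simp: lie_power_simps(1))
  have co2: "b i \<in> carrier B\<^sub>2" if "b \<in> carrier ?P2" "i \<in> {1..m}" for b i
    using that by (auto simp: lie_power_simps(1))
  obtain i0 where i0: "i0 \<in> {1..m}"
    and copy: "\<theta> ` single m B\<^sub>1 i0 ` carrier B\<^sub>1 = single m B\<^sub>2 1 ` carrier B\<^sub>2"
    using lie_iso_copy[OF B1 B2 \<theta> one] by blast
  \<comment> \<open>The restriction of \<theta> to the copy \<open>i0\<close>, which is mapped onto
    the first copy, read off in coordinate 1.\<close>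
  define \<psi> where "\<psi> b = \<theta> (single m B\<^sub>1 i0 b) 1" for b
  have \<theta>_single: "\<theta> (single m B\<^sub>1 i0 b) = single m B\<^sub>2 1 (\<psi> b)" if b: "b \<in> carrier B\<^sub>1" for b
  proof -
    have "\<theta> (single m B\<^sub>1 i0 b) \<in> single m B\<^sub>2 1 ` carrier B\<^sub>2" using copy b by blast
    then obtain z where "\<theta> (single m B\<^sub>1 i0 b) = single m B\<^sub>2 1 z" ..
    then show ?thesis using B2.single_at[OF one] by (simp add: \<psi>_def)
  qed
  have \<psi>_closed: "\<psi> b \<in> carrier B\<^sub>2" if "b \<in> carrier B\<^sub>1" for b
    unfolding \<psi>_def by (rule co2[OF \<theta>D(2)[OF B1.single_carrier[OF that]] one])
  have \<psi>_surj: "\<exists>b\<in>carrier B\<^sub>1. \<psi> b = y" if y: "y \<in> carrier B\<^sub>2" for y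
  proof -
    have "single m B\<^sub>2 1 y \<in> \<theta> ` single m B\<^sub>1 i0 ` carrier B\<^sub>1" using copy y by blast
    then obtain b where b: "b \<in> carrier B\<^sub>1" "single m B\<^sub>2 1 y = \<theta> (single m B\<^sub>1 i0 b)" by blast
    have "\<psi> b = y" unfolding \<psi>_def b(2)[symmetric] by (rule B2.single_at[OF one])
    with b(1) show ?thesis ..
  qed
  have "inj_on \<psi> (carrier B\<^sub>1)"
  proof (rule inj_onI)
    fix a b assume ab: "a \<in> carrier B\<^sub>1" "b \<in> carrier B\<^sub>1" "\<psi> a = \<psi> b"
    then have "\<theta> (single m B\<^sub>1 i0 a) = \<theta> (single m B\<^sub>1 i0 b)" by (simp add: \<theta>_single)
    then have "single m B\<^sub>1 i0 a = single m B\<^sub>1 i0 b"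
      using \<theta>D(1) ab B1.single_carrier by (auto simp: bij_betw_def dest: inj_onD)
    then show "a = b" using B1.single_at[OF i0] by metis
  qed
  then have "bij_betw \<psi> (carrier B\<^sub>1) (carrier B\<^sub>2)"
    using \<psi>_closed \<psi>_surj by (force simp: bij_betw_def)
  moreover have "\<psi> (a \<oplus>\<^bsub>B\<^sub>1\<^esub> b) = \<psi> a \<oplus>\<^bsub>B\<^sub>2\<^esub> \<psi> b" if "a \<in> carrier B\<^sub>1" "b \<in> carrier B\<^sub>1" for a b
    unfolding \<psi>_def using that one
    by (simp add: B1.single_add \<theta>D(3) B1.single_carrier) (simp add: lie_power_simps)
  moreover have "\<psi> (x \<odot>\<^bsub>B\<^sub>1\<^esub> a) = x \<odot>\<^bsub>B\<^sub>2\<^esub> \<psi> a" if "x \<in> carrier F" "a \<in> carrier B\<^sub>1" for x a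
    unfolding \<psi>_def using that one
    by (simp add: B1.single_smult \<theta>D(4) B1.single_carrier) (simp add: lie_power_simps)
  moreover have "\<psi> (a \<otimes>\<^bsub>B\<^sub>1\<^esub> b) = \<psi> a \<otimes>\<^bsub>B\<^sub>2\<^esub> \<psi> b" if ab: "a \<in> carrier B\<^sub>1" "b \<in> carrier B\<^sub>1" for a b
  proof -
    have "single m B\<^sub>1 i0 (a \<otimes>\<^bsub>B\<^sub>1\<^esub> b) = single m B\<^sub>1 i0 a \<otimes>\<^bsub>?P1\<^esub> single m B\<^sub>1 i0 b"
      using ab i0 by (simp only: B1.bracket_single B1.single_carrier B1.single_at)
    then show ?thesis
      unfolding \<psi>_def using ab one
      by (simp add: \<theta>D(5) B1.single_carrier) (simp add: lie_power_simps)
  qed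
  ultimately have \<psi>: "\<psi> \<in> lie_iso F B\<^sub>1 B\<^sub>2" by (simp add: lie_iso_def)
  note \<psi>_zero = lie_iso_zero[OF B1.lie_algebra_axioms B2.lie_algebra_axioms \<psi>]

  \<comment> \<open>A tuple vanishing at \<open>i0\<close> commutes with the copy \<open>i0\<close>.
    Its image therefore commutes with the first copy, so its first coordinate is central.\<close>
  have vanish: "\<theta> b 1 = \<zero>\<^bsub>B\<^sub>2\<^esub>" if b: "b \<in> carrier ?P1" and b0: "b i0 = \<zero>\<^bsub>B\<^sub>1\<^esub>" for b
  proof (rule B2.center_trivial)
    have \<theta>b: "\<theta> b \<in> carrier ?P2" by (rule \<theta>D(2)[OF b])
    then show "\<theta> b 1 \<in> carrier B\<^sub>2" using one by (rule co2)
    fix y assume "y \<in> carrier B\<^sub>2"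
    then obtain x where x: "x \<in> carrier B\<^sub>1" "\<psi> x = y" using \<psi>_surj by blast
    have "single m B\<^sub>1 i0 x \<otimes>\<^bsub>?P1\<^esub> b = \<zero>\<^bsub>?P1\<^esub>"
      using x(1) b by (simp add: B1.single_bracket b0 B1.single_zero)
    then have "single m B\<^sub>2 1 (\<psi> x) \<otimes>\<^bsub>?P2\<^esub> \<theta> b = \<zero>\<^bsub>?P2\<^esub>"
      using \<theta>D(5)[OF B1.single_carrier[OF x(1)] b] lie_iso_zero[OF P1 P2 \<theta>] \<theta>_single[OF x(1)]
      by metis
    then have "single m B\<^sub>2 1 (\<psi> x \<otimes>\<^bsub>B\<^sub>2\<^esub> \<theta> b 1) = \<zero>\<^bsub>?P2\<^esub>"
      using B2.single_bracket[OF \<theta>b \<psi>_closed[OF x(1)]] by metis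
    then show "y \<otimes>\<^bsub>B\<^sub>2\<^esub> \<theta> b 1 = \<zero>\<^bsub>B\<^sub>2\<^esub>"
      using B2.single_eq_zero[OF one] x(2) by blast
  qed
  have first: "\<theta> b 1 = \<psi> (b i0)" if b: "b \<in> carrier ?P1" for b
  proof -
    \<comment> \<open>Removing coordinate \<open>i0\<close> from \<open>b\<close> leaves a tuple to
      which \<open>vanish\<close> applies.\<close>
    define b' where "b' = (\<lambda>i\<in>{1..m}. if i = i0 then \<zero>\<^bsub>B\<^sub>1\<^esub> else b i)"
    have b': "b' \<in> carrier ?P1"
      using co1[OF b] by (simp add: b'_def lie_power_simps(1))
    have s: "single m B\<^sub>1 i0 (b i0) \<in> carrier ?P1"
      by (rule B1.single_carrier[OF co1[OF b i0]])
    have "b = b' \<oplus>\<^bsub>?P1\<^esub> single m B\<^sub>1 i0 (b i0)"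
    proof (rule lie_power_eqI[OF b P1.M.a_closed[OF b' s]])
      fix i assume "i \<in> {1..m}"
      then show "b i = (b' \<oplus>\<^bsub>?P1\<^esub> single m B\<^sub>1 i0 (b i0)) i"
        using co1[OF b] by (simp add: b'_def single_def lie_power_simps(4))
    qed
    then have "\<theta> b = \<theta> b' \<oplus>\<^bsub>?P2\<^esub> single m B\<^sub>2 1 (\<psi> (b i0))"
      using \<theta>D(3)[OF b' s] \<theta>_single[OF co1[OF b i0]] by metis
    then have "\<theta> b 1 = \<theta> b' 1 \<oplus>\<^bsub>B\<^sub>2\<^esub> \<psi> (b i0)"
      using one by (simp add: lie_power_simps(4) single_def)
    moreover have "\<theta> b' 1 = \<zero>\<^bsub>B\<^sub>2\<^esub>"
      by (rule vanish[OF b']) (use i0 in \<open>simp add: b'_def\<close>)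
    ultimately show ?thesis using \<psi>_closed[OF co1[OF b i0]] by simp
  qed

  \<comment> \<open>Chosen so that coordinate 1 of the image is read from position
    \<open>i0\<close>.\<close>
  define k where "k = i0 - 1"
  have k: "k < m" "rot m k 1 = i0" using i0 by (auto simp: k_def rot_def)
  have "\<theta> b (Suc n) = \<psi> (b (rot m k (Suc n)))" if "b \<in> carrier ?P1" "Suc n \<le> m" for b n
    using that
  proof (induction n arbitrary: b)
    case 0
    then show ?case using first k(2) by simp
  next
    case (Suc n)
    \<comment> \<open>The backward rotation of \<open>b\<close>, so that
      \<open>L_c m b' = b\<close>: coordinate \<open>Suc (Suc n)\<close> of the image of
      \<open>b\<close> is coordinate \<open>Suc n\<close> of the image of \<open>b'\<close>.\<close>
    define b' where "b' = (\<lambda>i\<in>{1..m}. b (if i = m then 1 else Suc i))"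
    have b': "b' \<in> carrier ?P1"
      using co1[OF Suc.prems(1)] m by (simp add: b'_def lie_power_simps(1))
    have "L_c m b' = b"
    proof (rule lie_power_eqI)
      show "L_c m b' \<in> carrier ?P1"
        using co1[OF b'] cyc_pred_in[of _ m] by (simp add: L_c_def lie_power_simps(1))
      show "L_c m b' i = b i" if "i \<in> {1..m}" for i
        using that by (auto simp: L_c_def b'_def cyc_pred_def)
    qed (rule Suc.prems)
    then have "\<theta> b (Suc (Suc n)) = L_c m (\<theta> b') (Suc (Suc n))"
      using shift[OF b'] by simp
    also have "\<dots> = \<theta> b' (Suc n)"
      using Suc.prems by (simp add: L_c_def cyc_pred_def)
    also have "\<dots> = \<psi> (b' (rot m k (Suc n)))"
      using Suc.IH[OF b'] Suc.prems by simp
    also have "b' (rot m k (Suc n)) = b (rot m k (Suc (Suc n)))"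
      using Suc.prems k(1) rot_in[OF k(1), of "Suc n"] rot_Suc[OF k(1), of "Suc n"]
      by (simp add: b'_def)
    finally show ?case .
  qed
  then have "\<theta> b i = \<psi> (b (rot m k i))" if "b \<in> carrier ?P1" "i \<in> {1..m}" for b i
    using that by (cases i) auto
  with k(1) \<psi> show ?thesis by blast
qed

section \<open>Taft module maps as maps commuting with c and v\<close>

context taft_power
begin

lemma L_alg_eq: "L_alg F m \<zeta> \<alpha> B = L_taft"
  by (simp add: L_alg_def)

lemma L_alg_simps:
  "carrier (L_alg F m \<zeta> \<alpha> B) = carrier P" "add (L_alg F m \<zeta> \<alpha> B) = add P"
  "mult (L_alg F m \<zeta> \<alpha> B) = mult P" "smult (L_alg F m \<zeta> \<alpha> B) = smult P"
  by (simp_all add: L_alg_def module.defs)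

lemma taft_module_lie_algebra_L_alg: "taft_module_lie_algebra F m \<zeta> (L_alg F m \<zeta> \<alpha> B)"
  unfolding L_alg_eq by (rule taft_module_lie_algebra_L_taft)

lemma taft_act_L_alg:
  "\<lbrakk>f \<in> carrier A; a \<in> carrier P\<rbrakk>
    \<Longrightarrow> taft_act (L_alg F m \<zeta> \<alpha> B) (taft_class F m \<zeta> f) a = act f a"
  unfolding L_alg_eq by (rule taft_act_class)

end

text \<open>One direction tests the classes of the one-letter words. The other passes from letters
  to words by induction and to arbitrary classes by linearity.\<close>

lemma taft_lie_iso_L_alg:
  assumes "taft_power F B\<^sub>1 m \<zeta> \<alpha>\<^sub>1" "taft_power F B\<^sub>2 m \<zeta> \<alpha>\<^sub>2"
  shows "\<theta> \<in> taft_lie_iso F m \<zeta> (L_alg F m \<zeta> \<alpha>\<^sub>1 B\<^sub>1) (L_alg F m \<zeta> \<alpha>\<^sub>2 B\<^sub>2) \<longleftrightarrow>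
    \<theta> \<in> lie_iso F (lie_power m B\<^sub>1) (lie_power m B\<^sub>2) \<and>
    (\<forall>a\<in>carrier (lie_power m B\<^sub>1). \<theta> (L_c m a) = L_c m (\<theta> a) \<and>
      \<theta> (L_v F m \<zeta> \<alpha>\<^sub>1 B\<^sub>1 a) = L_v F m \<zeta> \<alpha>\<^sub>2 B\<^sub>2 (\<theta> a))" (is "?l \<longleftrightarrow> ?iso \<and> ?comm")
proof -
  interpret T1: taft_power F B\<^sub>1 m \<zeta> \<alpha>\<^sub>1 by fact
  interpret T2: taft_power F B\<^sub>2 m \<zeta> \<alpha>\<^sub>2 by fact
  let ?act = "\<lambda>h a. taft_act (L_alg F m \<zeta> \<alpha>\<^sub>1 B\<^sub>1) h a" and ?act' = "\<lambda>h a. taft_act (L_alg F m \<zeta> \<alpha>\<^sub>2 B\<^sub>2) h a"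
  have l: "?l \<longleftrightarrow> ?iso \<and> (\<forall>h\<in>carrier (taft_algebra F m \<zeta>). \<forall>a\<in>carrier T1.P. \<theta> (?act h a) = ?act' h (\<theta> a))"
    unfolding taft_lie_iso_def lie_iso_def T1.L_alg_simps T2.L_alg_simps by blast
  have "(\<forall>h\<in>carrier (taft_algebra F m \<zeta>). \<forall>a\<in>carrier T1.P. \<theta> (?act h a) = ?act' h (\<theta> a)) \<longleftrightarrow> ?comm"
    if iso: ?iso
  proof
    note \<theta> = lie_isoD[OF iso]
    assume H: "\<forall>h\<in>carrier (taft_algebra F m \<zeta>). \<forall>a\<in>carrier T1.P. \<theta> (?act h a) = ?act' h (\<theta> a)"
    have "\<theta> (T1.word_act w a) = T2.word_act w (\<theta> a)" if a: "a \<in> carrier T1.P" for w a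
    proof -
      have "\<theta> (?act (taft_class F m \<zeta> (free_word F w)) a) = ?act' (taft_class F m \<zeta> (free_word F w)) (\<theta> a)"
        using H a T1.taft_class_carrier[OF T1.free_word_carrier] by blast
      then show ?thesis
        using a \<theta>(2) by (simp add: T1.taft_act_L_alg T2.taft_act_L_alg T1.act_free_word T2.act_free_word)
    qed
    from this[of _ "[Gen_c]"] this[of _ "[Gen_v]"] show ?comm by simp
  next
    note \<theta> = lie_isoD[OF iso]
    assume C: ?comm
    have word: "\<theta> (T1.word_act w a) = T2.word_act w (\<theta> a)" if a: "a \<in> carrier T1.P" for w a
    proof (induction w)
      case (Cons g w)
      then show ?case using C T1.word_act_closed[OF a, of w] by (cases g) simp_all
    qed simp
    show "\<forall>h\<in>carrier (taft_algebra F m \<zeta>). \<forall>a\<in>carrier T1.P. \<theta> (?act h a) = ?act' h (\<theta> a)"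
    proof (intro ballI)
      fix h a assume h: "h \<in> carrier (taft_algebra F m \<zeta>)" and a: "a \<in> carrier T1.P"
      obtain f where f: "f \<in> carrier T1.A" "h = taft_class F m \<zeta> f"
        using h by (rule T1.taft_algebra_carrierE)
      have c: "f w \<in> carrier F" for w using f(1) by (simp add: carrier_free_algebra)
      have "\<theta> (T1.act f a)
        = finsum T2.P (\<lambda>w. \<theta> (f w \<odot>\<^bsub>T1.P\<^esub> T1.word_act w a)) {w. f w \<noteq> \<zero>\<^bsub>F\<^esub>}"
        unfolding free_act_def
        by (rule additive_finsum[OF T1.L_group T2.L_group]) (use \<theta> a c in auto)
      also have "\<dots> = T2.act f (\<theta> a)"
        unfolding free_act_def using \<theta>(2,4) a c word
        by (intro T2.M.finsum_cong') auto
      finally show "\<theta> (?act h a) = ?act' h (\<theta> a)"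
        using f a \<theta>(2) by (simp add: T1.taft_act_L_alg T2.taft_act_L_alg)
    qed
  qed
  with l show ?thesis by blast
qed

section \<open>Exponents of the root of unity\<close>

context taft_power
begin

lemma \<zeta>_pow_add_multiple: "\<zeta> [^]\<^bsub>F\<^esub> (n + m * q) = \<zeta> [^]\<^bsub>F\<^esub> (n::nat)"
  by (simp add: nat_pow_mult[symmetric] nat_pow_pow[symmetric] \<zeta>_pow_m)

lemma \<zeta>_pow_mod: "\<zeta> [^]\<^bsub>F\<^esub> (n mod m) = \<zeta> [^]\<^bsub>F\<^esub> (n::nat)"
  using \<zeta>_pow_add_multiple[of "n mod m" "n div m"] by simp

text \<open>Turns an arbitrary integer exponent into an actual rotation of \<open>m\<close>
  positions.\<close>

lemma \<zeta>_int_pow: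
  fixes k :: int
  shows "\<exists>r<m. \<zeta> [^]\<^bsub>F\<^esub> k = \<zeta> [^]\<^bsub>F\<^esub> r"
proof -
  have "\<exists>n::nat. \<zeta> [^]\<^bsub>F\<^esub> k = \<zeta> [^]\<^bsub>F\<^esub> n"
  proof (cases "k < 0")
    case True
    let ?n = "nat (- k)"
    \<comment> \<open>For a negative exponent the inverse is realised by a natural one, with
      \<open>m - 1\<close> standing for -1; the two exponents add up to a multiple of
      \<open>m\<close>.\<close>
    have "?n + ?n * (m - 1) = 0 + m * ?n" using m_pos by (simp add: algebra_simps)
    then have "\<zeta> [^]\<^bsub>F\<^esub> (?n + ?n * (m - 1)) = \<one>\<^bsub>F\<^esub>"
      by (simp only: \<zeta>_pow_add_multiple nat_pow_0)
    then have "\<zeta> [^]\<^bsub>F\<^esub> ?n \<otimes>\<^bsub>F\<^esub> \<zeta> [^]\<^bsub>F\<^esub> (?n * (m - 1)) = \<one>\<^bsub>F\<^esub>"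
      by (simp only: nat_pow_mult \<zeta>_closed)
    then have "inv\<^bsub>F\<^esub> (\<zeta> [^]\<^bsub>F\<^esub> ?n) = \<zeta> [^]\<^bsub>F\<^esub> (?n * (m - 1))"
      by (rule comm_inv_char[rotated 2]) simp_all
    moreover have "\<zeta> [^]\<^bsub>F\<^esub> k = inv\<^bsub>F\<^esub> (\<zeta> [^]\<^bsub>F\<^esub> ?n)"
      by (subst int_pow_def2) (simp only: True if_True)
    ultimately have "\<zeta> [^]\<^bsub>F\<^esub> k = \<zeta> [^]\<^bsub>F\<^esub> (?n * (m - 1))" by (rule trans[rotated])
    then show ?thesis ..
  next
    case False
    have "\<zeta> [^]\<^bsub>F\<^esub> k = \<zeta> [^]\<^bsub>F\<^esub> nat k"
      by (subst int_pow_def2) (simp only: False if_False)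
    then show ?thesis ..
  qed
  then obtain n :: nat where "\<zeta> [^]\<^bsub>F\<^esub> k = \<zeta> [^]\<^bsub>F\<^esub> n" ..
  then show ?thesis
    using m_pos \<zeta>_pow_mod[of n] mod_less_divisor[of m n] by (intro exI[of _ "n mod m"] conjI) simp_all
qed

text \<open>Rotating the positions by \<open>k\<close> multiplies the diagonal D by \<zeta>^k. This
  is the origin of the factor between the two parameters.\<close>

lemma \<zeta>_pow_rot:
  assumes "k < m" "i \<in> {1..m}"
  shows "\<zeta> [^]\<^bsub>F\<^esub> (rot m k i - 1) = \<zeta> [^]\<^bsub>F\<^esub> k \<otimes>\<^bsub>F\<^esub> \<zeta> [^]\<^bsub>F\<^esub> (i - 1)"
proof -
  have "k + (i - 1) = rot m k i - 1 \<or> k + (i - 1) = rot m k i - 1 + m * 1"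
    using assms by (auto simp: rot_def)
  then show ?thesis
    using \<zeta>_pow_add_multiple[of "rot m k i - 1" 1] by (auto simp: nat_pow_mult)
qed

end

text \<open>Comparing the actions of \<open>v\<close> on an element supported at the position which the shift moves
  to the first coordinate.\<close>

lemma shift_parameter:
  assumes "taft_power F B\<^sub>1 m \<zeta> \<alpha>\<^sub>1" "taft_power F B\<^sub>2 m \<zeta> \<alpha>\<^sub>2" "simple_lie_algebra F B\<^sub>1"
    and m: "2 \<le> m" and k: "k < m" and \<psi>: "\<psi> \<in> lie_iso F B\<^sub>1 B\<^sub>2"
    and \<theta>: "\<And>b i. \<lbrakk>b \<in> carrier (lie_power m B\<^sub>1); i \<in> {1..m}\<rbrakk> \<Longrightarrow> \<theta> b i = \<psi> (b (rot m k i))"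
    and v: "\<And>a. a \<in> carrier (lie_power m B\<^sub>1)
      \<Longrightarrow> \<theta> (L_v F m \<zeta> \<alpha>\<^sub>1 B\<^sub>1 a) = L_v F m \<zeta> \<alpha>\<^sub>2 B\<^sub>2 (\<theta> a)"
  shows "\<alpha>\<^sub>2 = \<zeta> [^]\<^bsub>F\<^esub> k \<otimes>\<^bsub>F\<^esub> \<alpha>\<^sub>1"
proof -
  have L1: "lie_algebra F B\<^sub>1" and L2: "lie_algebra F B\<^sub>2"
    using assms(1,2) by (auto dest: taft_power.axioms(1))
  interpret B1: lie_algebra F B\<^sub>1 by (rule L1)
  interpret B2: lie_algebra F B\<^sub>2 by (rule L2)
  interpret T1: taft_power F B\<^sub>1 m \<zeta> \<alpha>\<^sub>1 by fact
  interpret T2: taft_power F B\<^sub>2 m \<zeta> \<alpha>\<^sub>2 by fact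
  interpret S1: simple_lie_algebra F B\<^sub>1 by fact
  note \<psi>D = lie_isoD[OF \<psi>] and \<psi>0 = lie_iso_zero[OF L1 L2 \<psi>]
  obtain x where x: "x \<in> carrier B\<^sub>1" "x \<noteq> \<zero>\<^bsub>B\<^sub>1\<^esub>" using S1.exists_nonzero by blast
  let ?b = "single m B\<^sub>1 (Suc k) x"
  have b: "?b \<in> carrier T1.P" by (rule T1.single_closed[OF x(1)])
  have \<psi>x: "\<psi> x \<in> carrier B\<^sub>2" "\<psi> x \<noteq> \<zero>\<^bsub>B\<^sub>2\<^esub>"
    using \<psi>D(2) lie_iso_eq_zero[OF L1 L2 \<psi>] x by auto
  have one: "1 \<in> {1..m}" "rot m k 1 = Suc k" "Suc k \<in> {1..m}" "m \<in> {1..m}" "cyc_pred m 1 = m"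
    using k m by (auto simp: rot_def cyc_pred_def)
  \<comment> \<open>Here \<open>2 \<le> m\<close> matters: with a single position the difference
    defining v would vanish identically and carry no information on the parameter.\<close>
  have "cyc_pred m (Suc k) \<in> {1..m}" "cyc_pred m (Suc k) \<noteq> Suc k"
    using m k by (auto simp: cyc_pred_def)
  then have "L_v F m \<zeta> \<alpha>\<^sub>1 B\<^sub>1 ?b (Suc k) = \<alpha>\<^sub>1 \<odot>\<^bsub>B\<^sub>1\<^esub> (\<zeta> [^]\<^bsub>F\<^esub> k \<odot>\<^bsub>B\<^sub>1\<^esub> x)"
    using one(3) x(1) by (simp add: L_v_def single_def B1.minus_zero)
  then have "\<theta> (L_v F m \<zeta> \<alpha>\<^sub>1 B\<^sub>1 ?b) 1 = \<alpha>\<^sub>1 \<odot>\<^bsub>B\<^sub>2\<^esub> (\<zeta> [^]\<^bsub>F\<^esub> k \<odot>\<^bsub>B\<^sub>2\<^esub> \<psi> x)"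
    using \<theta>[OF T1.L_v_closed[OF b] one(1)] one(2) x(1) by (simp add: \<psi>D(4))
  moreover have "L_v F m \<zeta> \<alpha>\<^sub>2 B\<^sub>2 (\<theta> ?b) 1 = \<alpha>\<^sub>2 \<odot>\<^bsub>B\<^sub>2\<^esub> \<psi> x"
  proof -
    \<comment> \<open>The wrap-around term in coordinate 1 is coordinate \<open>m\<close> of the
      image, which is read from a position where the tuple is zero.\<close>
    have "rot m k m \<in> {1..m}" "rot m k m \<noteq> Suc k" using k m by (auto simp: rot_def)
    then have "\<theta> ?b m = \<zero>\<^bsub>B\<^sub>2\<^esub>" using \<theta>[OF b one(4)] by (simp add: single_def \<psi>0)
    moreover have "\<theta> ?b 1 = \<psi> x" using \<theta>[OF b one(1)] one(2,3) by (simp add: single_def)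
    ultimately show ?thesis
      using one(1,5) \<psi>x(1) by (simp add: L_v_def B2.minus_zero)
  qed
  ultimately have eq: "\<alpha>\<^sub>1 \<odot>\<^bsub>B\<^sub>2\<^esub> (\<zeta> [^]\<^bsub>F\<^esub> k \<odot>\<^bsub>B\<^sub>2\<^esub> \<psi> x) = \<alpha>\<^sub>2 \<odot>\<^bsub>B\<^sub>2\<^esub> \<psi> x" using v[OF b] by simp
  have "(\<alpha>\<^sub>2 \<ominus>\<^bsub>F\<^esub> \<zeta> [^]\<^bsub>F\<^esub> k \<otimes>\<^bsub>F\<^esub> \<alpha>\<^sub>1) \<odot>\<^bsub>B\<^sub>2\<^esub> \<psi> x = \<zero>\<^bsub>B\<^sub>2\<^esub>"
    using \<psi>x(1) eq
    by (simp add: B2.smult_minus_left B2.smult_assoc1 B1.m_comm[of "\<zeta> [^]\<^bsub>F\<^esub> k" \<alpha>\<^sub>1]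
        B2.M.minus_eq B2.M.r_neg)
  then have "\<alpha>\<^sub>2 \<ominus>\<^bsub>F\<^esub> \<zeta> [^]\<^bsub>F\<^esub> k \<otimes>\<^bsub>F\<^esub> \<alpha>\<^sub>1 = \<zero>\<^bsub>F\<^esub>"
    using \<psi>x abelian_group.minus_closed[OF B1.F_group] by (intro B2.smult_eq_zero[OF _ \<psi>x(1) _ \<psi>x(2)]) simp_all
  then show ?thesis by (rule B1.F_eq_if_minus_zero) simp_all
qed

text \<open>Every rotation combined with a Lie isomorphism commutes with c by
  \<open>rot_cyc_pred\<close>; for v the scalar \<zeta>^k from \<open>\<zeta>_pow_rot\<close> is
  absorbed by the change of parameter.\<close>

lemma shift_taft_lie_iso:
  assumes "taft_power F B\<^sub>1 m \<zeta> \<alpha>\<^sub>1" "taft_power F B\<^sub>2 m \<zeta> \<alpha>\<^sub>2"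
    and k: "k < m" and \<psi>: "\<psi> \<in> lie_iso F B\<^sub>1 B\<^sub>2" and \<alpha>: "\<alpha>\<^sub>2 = \<zeta> [^]\<^bsub>F\<^esub> k \<otimes>\<^bsub>F\<^esub> \<alpha>\<^sub>1"
  shows "(\<lambda>b. \<lambda>i\<in>{1..m}. \<psi> (b (rot m k i)))
    \<in> taft_lie_iso F m \<zeta> (L_alg F m \<zeta> \<alpha>\<^sub>1 B\<^sub>1) (L_alg F m \<zeta> \<alpha>\<^sub>2 B\<^sub>2)" (is "?\<theta> \<in> _")
proof -
  have L1: "lie_algebra F B\<^sub>1" and L2: "lie_algebra F B\<^sub>2"
    using assms(1,2) by (auto dest: taft_power.axioms(1))
  interpret B1: lie_algebra F B\<^sub>1 by (rule L1)
  interpret B2: lie_algebra F B\<^sub>2 by (rule L2)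
  interpret T1: taft_power F B\<^sub>1 m \<zeta> \<alpha>\<^sub>1 by fact
  interpret T2: taft_power F B\<^sub>2 m \<zeta> \<alpha>\<^sub>2 by fact
  note \<psi>D = lie_isoD[OF \<psi>] and \<psi>_minus = lie_iso_minus[OF L1 L2 \<psi>]
  have co: "a i \<in> carrier B\<^sub>1" if "a \<in> carrier T1.P" "i \<in> {1..m}" for a i
    using that by auto
  note rot = rot_in[OF k]
  have \<theta>_closed: "?\<theta> a \<in> carrier T2.P" if "a \<in> carrier T1.P" for a
    using \<psi>D(2) co[OF that rot] by (simp add: lie_power_simps(1))
  have "inj_on ?\<theta> (carrier T1.P)"
  proof (rule inj_onI)
    fix a b assume ab: "a \<in> carrier T1.P" "b \<in> carrier T1.P" "?\<theta> a = ?\<theta> b"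
    show "a = b"
    proof (rule lie_power_eqI[OF ab(1,2)])
      fix i assume i: "i \<in> {1..m}"
      then obtain j where j: "j \<in> {1..m}" "rot m k j = i" using rot_surj[OF k] by blast
      then have "\<psi> (a i) = \<psi> (b i)" using fun_cong[OF ab(3), of j] by simp
      then show "a i = b i"
        using \<psi>D(1) co[OF ab(1) i] co[OF ab(2) i] by (meson bij_betw_def inj_onD)
    qed
  qed
  moreover have "\<exists>a\<in>carrier T1.P. y = ?\<theta> a" if y: "y \<in> carrier T2.P" for y
  proof -
    \<comment> \<open>A preimage is found by undoing the rotation with \<open>g\<close> and then
      \<open>\<psi>\<close> coordinatewise with \<open>h\<close>.\<close>
    define g where "g = inv_into {1..m} (rot m k)"
    define h where "h = inv_into (carrier B\<^sub>1) \<psi>"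
    have g: "g i \<in> {1..m}" if "i \<in> {1..m}" for i
      unfolding g_def using rot_surj[OF k that] by (intro inv_into_into) blast
    have g_rot: "g (rot m k i) = i" if "i \<in> {1..m}" for i
      unfolding g_def using rot_inj[OF k] that by (rule inv_into_f_f)
    have h: "h z \<in> carrier B\<^sub>1" "\<psi> (h z) = z" if "z \<in> carrier B\<^sub>2" for z
      unfolding h_def using \<psi>D(1) that by (simp_all add: bij_betw_def inv_into_into f_inv_into_f)
    have yc: "y i \<in> carrier B\<^sub>2" if "i \<in> {1..m}" for i using that y by auto
    let ?a = "\<lambda>i\<in>{1..m}. h (y (g i))"
    have a: "?a \<in> carrier T1.P" using h(1) yc g by (simp add: lie_power_simps(1))
    have "y = ?\<theta> ?a"
      by (rule lie_power_eqI[OF y \<theta>_closed[OF a]]) (use rot g_rot h(2) yc in simp)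
    then show ?thesis using a by (rule bexI)
  qed
  ultimately have "bij_betw ?\<theta> (carrier T1.P) (carrier T2.P)"
    using \<theta>_closed by (auto simp: bij_betw_def)
  then have "?\<theta> \<in> lie_iso F T1.P T2.P"
    unfolding lie_iso_def using rot co
    by (auto simp: lie_power_simps(2,4,5) \<psi>D intro!: restrict_ext)
  moreover have "?\<theta> (L_c m a) = L_c m (?\<theta> a)" for a
    unfolding L_c_def by (rule restrict_ext) (simp only: restrict_apply' rot rot_cyc_pred[OF k] cyc_pred_in)
  moreover have "?\<theta> (L_v F m \<zeta> \<alpha>\<^sub>1 B\<^sub>1 a) = L_v F m \<zeta> \<alpha>\<^sub>2 B\<^sub>2 (?\<theta> a)" if a: "a \<in> carrier T1.P" for a
    unfolding L_v_def
  proof (rule restrict_ext)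
    fix i assume i: "i \<in> {1..m}"
    let ?x = "a (rot m k i)" and ?y = "a (cyc_pred m (rot m k i))"
    have xy: "?x \<in> carrier B\<^sub>1" "?y \<in> carrier B\<^sub>1"
      using co[OF a] rot[OF i] cyc_pred_in[OF rot[OF i]] by auto
    have "\<psi> (\<alpha>\<^sub>1 \<odot>\<^bsub>B\<^sub>1\<^esub> (\<zeta> [^]\<^bsub>F\<^esub> (rot m k i - 1) \<odot>\<^bsub>B\<^sub>1\<^esub> (?x \<ominus>\<^bsub>B\<^sub>1\<^esub> ?y)))
      = \<alpha>\<^sub>1 \<odot>\<^bsub>B\<^sub>2\<^esub> (\<zeta> [^]\<^bsub>F\<^esub> (rot m k i - 1) \<odot>\<^bsub>B\<^sub>2\<^esub> (\<psi> ?x \<ominus>\<^bsub>B\<^sub>2\<^esub> \<psi> ?y))"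
      using xy by (simp add: \<psi>D(4) \<psi>_minus)
    also have "\<dots> = \<alpha>\<^sub>2 \<odot>\<^bsub>B\<^sub>2\<^esub> (\<zeta> [^]\<^bsub>F\<^esub> (i - 1) \<odot>\<^bsub>B\<^sub>2\<^esub> (\<psi> ?x \<ominus>\<^bsub>B\<^sub>2\<^esub> \<psi> ?y))"
      unfolding T1.\<zeta>_pow_rot[OF k i] \<alpha> using xy \<psi>D(2)
      by (simp add: B2.smult_assoc1[symmetric] B1.m_ac)
    finally show "\<psi> ((\<lambda>i\<in>{1..m}. \<alpha>\<^sub>1 \<odot>\<^bsub>B\<^sub>1\<^esub> (\<zeta> [^]\<^bsub>F\<^esub> (i - 1) \<odot>\<^bsub>B\<^sub>1\<^esub> (a i \<ominus>\<^bsub>B\<^sub>1\<^esub> a (cyc_pred m i)))) (rot m k i))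
      = \<alpha>\<^sub>2 \<odot>\<^bsub>B\<^sub>2\<^esub> (\<zeta> [^]\<^bsub>F\<^esub> (i - 1) \<odot>\<^bsub>B\<^sub>2\<^esub> (?\<theta> a i \<ominus>\<^bsub>B\<^sub>2\<^esub> ?\<theta> a (cyc_pred m i)))"
      by (simp only: restrict_apply' i rot rot_cyc_pred[OF k] cyc_pred_in)
  qed
  ultimately show ?thesis
    using taft_lie_iso_L_alg[OF assms(1,2)] by blast
qed

theorem theorem3p3:
  fixes F :: "('f, 'r) ring_scheme"
    and m :: nat
    and \<zeta> \<alpha>\<^sub>1 \<alpha>\<^sub>2 :: 'f
    and B\<^sub>1 :: "('f, 'a, 's) module_scheme"
    and B\<^sub>2 :: "('f, 'b, 't) module_scheme"
  assumes "m \<ge> 2"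
    and "field F"
    and "primitive_root F m \<zeta>"
    and "simple_lie_algebra F B\<^sub>1"
    and "simple_lie_algebra F B\<^sub>2"
    and "\<alpha>\<^sub>1 \<in> carrier F"
    and "\<alpha>\<^sub>2 \<in> carrier F"
  shows "(\<forall>\<theta>. \<theta> \<in> taft_lie_iso F m \<zeta> (L_alg F m \<zeta> \<alpha>\<^sub>1 B\<^sub>1) (L_alg F m \<zeta> \<alpha>\<^sub>2 B\<^sub>2) \<longrightarrow>
            (\<exists>k \<psi>. k \<le> m - 1 \<and> \<psi> \<in> lie_iso F B\<^sub>1 B\<^sub>2 \<and>
               (\<forall>b \<in> {1..m} \<rightarrow>\<^sub>E carrier B\<^sub>1.
                  \<theta> b = (\<lambda>i\<in>{1..m}. \<psi> (b (if i \<le> m - k then k + i else i - (m - k))))) \<and>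
               \<alpha>\<^sub>2 = \<zeta> [^]\<^bsub>F\<^esub> k \<otimes>\<^bsub>F\<^esub> \<alpha>\<^sub>1))
       \<and> (lie_iso F B\<^sub>1 B\<^sub>2 \<noteq> {} \<and> (\<exists>k::int. \<alpha>\<^sub>2 = \<zeta> [^]\<^bsub>F\<^esub> k \<otimes>\<^bsub>F\<^esub> \<alpha>\<^sub>1) \<longrightarrow>
            taft_lie_isomorphic F m \<zeta> (L_alg F m \<zeta> \<alpha>\<^sub>1 B\<^sub>1) (L_alg F m \<zeta> \<alpha>\<^sub>2 B\<^sub>2))"
proof -
  have T1: "taft_power F B\<^sub>1 m \<zeta> \<alpha>\<^sub>1" and T2: "taft_power F B\<^sub>2 m \<zeta> \<alpha>\<^sub>2"
    using assms by (auto intro!: taft_power.intro taft_power_axioms.intro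
        dest: simple_lie_algebra.axioms(1))
  interpret T1: taft_power F B\<^sub>1 m \<zeta> \<alpha>\<^sub>1 by (rule T1)
  interpret T2: taft_power F B\<^sub>2 m \<zeta> \<alpha>\<^sub>2 by (rule T2)
  show ?thesis
  proof (intro conjI allI impI)
    fix \<theta> assume "\<theta> \<in> taft_lie_iso F m \<zeta> (L_alg F m \<zeta> \<alpha>\<^sub>1 B\<^sub>1) (L_alg F m \<zeta> \<alpha>\<^sub>2 B\<^sub>2)"
    then have \<theta>: "\<theta> \<in> lie_iso F T1.P T2.P"
      and c: "\<And>a. a \<in> carrier T1.P \<Longrightarrow> \<theta> (L_c m a) = L_c m (\<theta> a)"
      and v: "\<And>a. a \<in> carrier T1.P \<Longrightarrow> \<theta> (L_v F m \<zeta> \<alpha>\<^sub>1 B\<^sub>1 a) = L_v F m \<zeta> \<alpha>\<^sub>2 B\<^sub>2 (\<theta> a)"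
      using taft_lie_iso_L_alg[OF T1 T2] by blast+
    obtain k \<psi> where k: "k < m" and \<psi>: "\<psi> \<in> lie_iso F B\<^sub>1 B\<^sub>2"
      and eq: "\<And>b i. \<lbrakk>b \<in> carrier T1.P; i \<in> {1..m}\<rbrakk> \<Longrightarrow> \<theta> b i = \<psi> (b (rot m k i))"
      using lie_iso_power_shift[OF assms(4,5) T1.m_pos \<theta> c] by blast
    have "\<theta> b = (\<lambda>i\<in>{1..m}. \<psi> (b (if i \<le> m - k then k + i else i - (m - k))))"
      if "b \<in> {1..m} \<rightarrow>\<^sub>E carrier B\<^sub>1" for b
    proof -
      have b: "b \<in> carrier T1.P" using that by (simp only: lie_power_simps(1))
      \<comment> \<open>The coordinate formula covers only \<open>{1..m}\<close>; extensionality of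
        the image fixes its value elsewhere, which gives equality of functions.\<close>
      have "\<theta> b \<in> {1..m} \<rightarrow>\<^sub>E carrier B\<^sub>2"
        using lie_isoD(2)[OF \<theta> b] by (simp only: lie_power_simps(1))
      then show ?thesis
        unfolding rot_def[symmetric] using eq[OF b] PiE_restrict
        by (intro extensionalityI[of _ "{1..m}"]) (auto simp: PiE_iff)
    qed
    moreover have "\<alpha>\<^sub>2 = \<zeta> [^]\<^bsub>F\<^esub> k \<otimes>\<^bsub>F\<^esub> \<alpha>\<^sub>1"
      by (rule shift_parameter[OF T1 T2 assms(4,1) k \<psi> eq v])
    ultimately show "\<exists>k \<psi>. k \<le> m - 1 \<and> \<psi> \<in> lie_iso F B\<^sub>1 B\<^sub>2 \<and>
               (\<forall>b \<in> {1..m} \<rightarrow>\<^sub>E carrier B\<^sub>1.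
                  \<theta> b = (\<lambda>i\<in>{1..m}. \<psi> (b (if i \<le> m - k then k + i else i - (m - k))))) \<and>
               \<alpha>\<^sub>2 = \<zeta> [^]\<^bsub>F\<^esub> k \<otimes>\<^bsub>F\<^esub> \<alpha>\<^sub>1"
      using k \<psi> by (intro exI[of _ k] exI[of _ \<psi>]) auto
  next
    assume "lie_iso F B\<^sub>1 B\<^sub>2 \<noteq> {} \<and> (\<exists>k::int. \<alpha>\<^sub>2 = \<zeta> [^]\<^bsub>F\<^esub> k \<otimes>\<^bsub>F\<^esub> \<alpha>\<^sub>1)"
    then obtain \<psi> and k :: int
      where \<psi>: "\<psi> \<in> lie_iso F B\<^sub>1 B\<^sub>2" and "\<alpha>\<^sub>2 = \<zeta> [^]\<^bsub>F\<^esub> k \<otimes>\<^bsub>F\<^esub> \<alpha>\<^sub>1" by blast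
    \<comment> \<open>The exponent is replaced by its residue, which is the amount of the
      rotation.\<close>
    then obtain r where r: "r < m" "\<alpha>\<^sub>2 = \<zeta> [^]\<^bsub>F\<^esub> r \<otimes>\<^bsub>F\<^esub> \<alpha>\<^sub>1"
      using T1.\<zeta>_int_pow[of k] by metis
    show "taft_lie_isomorphic F m \<zeta> (L_alg F m \<zeta> \<alpha>\<^sub>1 B\<^sub>1) (L_alg F m \<zeta> \<alpha>\<^sub>2 B\<^sub>2)"
      unfolding taft_lie_isomorphic_def
      using T1.taft_module_lie_algebra_L_alg T2.taft_module_lie_algebra_L_alg
        shift_taft_lie_iso[OF T1 T2 r(1) \<psi> r(2)] by blast
  qed
qed


end
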